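(* Let $\mathbb F$ be a local field of characteristic zero, $G_n=\mathrm{GL}_n(\mathbb F)$, $\mathfrak g_n=\mathfrak{gl}_n(\mathbb F)$, and let $\mathcal O,\mathcal O'\subset\mathfrak g_n^*$ be nilpotent coadjoint orbits with $\mathcal O\subset\overline{\mathcal O'}$. Then there exists a Whittaker pair $(S,\tilde\varphi)\in\mathfrak g_n\times\mathfrak g_n^*$ such that $\tilde\varphi\in\mathcal O'$ and $\mathcal O$ intersects $\overline{(G_n)_S\tilde\varphi}$, where $(G_n)_S$ is the centralizer of $S$ in $G_n$. Moreover, $S$ can be chosen to be diagonal with integer eigenvalues and $\tilde\varphi$ can be chosen to be given by the trace pairing with a matrix in Jordan form.
   Context: A Whittaker pair is $(S,\varphi)\in\mathfrak g_n\times\mathfrak g_n^*$ such that $ad(S)$ is diagonalizable with rational eigenvalues and $ad^*(S)\varphi=-2\varphi$. $\mathfrak g_n^*$ is identified with $\mathfrak g_n$ by the trace form $X\mapsto(Y\mapsto\mathrm{Tr}(XY))$; nilpotent elements of $\mathfrak g_n^*$ correspond to nilpotent matrices. Jordan form means block diagonal with nilpotent Jordan blocks, taken lower triangular in the paper (ones just below the diagonal). Closures are in the topology of $\mathbb F$. *)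

theory Defs
  imports
    "HOL-Analysis.Analysis"
    "HOL-Algebra.Group_Action"
    "Jordan_Normal_Form.Jordan_Normal_Form"
    "Jordan_Normal_Form.VS_Connect"
begin

text \<open>A local field is a non-discrete, locally compact, Hausdorff topological field.
  Non-discreteness is \<^class>\<open>perfect_space\<close>, characteristic zero is \<^class>\<open>field_char_0\<close>.\<close>

class local_field_char_0 =
  field_char_0 + topological_ab_group_add + topological_semigroup_mult +
  perfect_space + t2_space +
  assumes tendsto_inverse_nhds: "a \<noteq> 0 \<Longrightarrow> (inverse \<longlongrightarrow> inverse a) (nhds a)"
    and locally_compact: "\<exists>U K. open U \<and> compact K \<and> x \<in> U \<and> U \<subseteq> K"

instance real :: local_field_char_0
proof
  fix a x :: real
  show "(inverse \<longlongrightarrow> inverse a) (nhds a)" if "a \<noteq> 0"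
    using that by (intro tendsto_intros filterlim_ident) auto
  show "\<exists>U K. open U \<and> compact K \<and> x \<in> U \<and> U \<subseteq> K"
    by (intro exI[of _ "ball x 1"] exI[of _ "cball x 1"]) auto
qed

instance complex :: local_field_char_0
proof
  fix a x :: complex
  show "(inverse \<longlongrightarrow> inverse a) (nhds a)" if "a \<noteq> 0"
    using that by (intro tendsto_intros filterlim_ident) auto
  show "\<exists>U K. open U \<and> compact K \<and> x \<in> U \<and> U \<subseteq> K"
    by (intro exI[of _ "ball x 1"] exI[of _ "cball x 1"]) auto
qed

definition GL :: "nat \<Rightarrow> 'a::field mat monoid" where
  "GL n = units_of (ring_mat TYPE('a) n ())"

definition GL_centralizer :: "nat \<Rightarrow> 'a::field mat \<Rightarrow> 'a mat monoid" where
  "GL_centralizer n S = (GL n)\<lparr>carrier := {g \<in> carrier (GL n). g * S = S * g}\<rparr>"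

text \<open>The Lie algebra is \<^term>\<open>carrier_mat n n\<close>. Elements of its dual are functions on
  matrices that are linear on \<^term>\<open>carrier_mat n n\<close> and \<^const>\<open>undefined\<close> outside.\<close>

definition gl_dual :: "nat \<Rightarrow> ('a::field mat \<Rightarrow> 'a) set" where
  "gl_dual n = {\<phi> \<in> extensional (carrier_mat n n).
     (\<forall>X \<in> carrier_mat n n. \<forall>Y \<in> carrier_mat n n. \<phi> (X + Y) = \<phi> X + \<phi> Y) \<and>
     (\<forall>c. \<forall>X \<in> carrier_mat n n. \<phi> (c \<cdot>\<^sub>m X) = c * \<phi> X)}"

text \<open>Pointwise convergence; since functionals are determined linearly by their values on the
  elementary matrices, this is the topology of the finite-dimensional space over the field,
  i.e. entrywise convergence of the matrices that represent them under the trace form.\<close>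

definition gl_dual_topology :: "nat \<Rightarrow> ('a::{field,topological_space} mat \<Rightarrow> 'a) topology" where
  "gl_dual_topology n =
     subtopology (product_topology (\<lambda>_. euclidean) (carrier_mat n n)) (gl_dual n)"

definition mat_trace :: "'a::comm_monoid_add mat \<Rightarrow> 'a" where
  "mat_trace A = (\<Sum>i<dim_row A. A $$ (i, i))"

definition trace_form :: "nat \<Rightarrow> 'a::field mat \<Rightarrow> 'a mat \<Rightarrow> 'a" where
  "trace_form n X = (\<lambda>Y \<in> carrier_mat n n. mat_trace (X * Y))"

definition lie_ad :: "'a::field mat \<Rightarrow> 'a mat \<Rightarrow> 'a mat" where
  "lie_ad S X = S * X - X * S"

definition lie_coad :: "nat \<Rightarrow> 'a::field mat \<Rightarrow> ('a mat \<Rightarrow> 'a) \<Rightarrow> 'a mat \<Rightarrow> 'a" where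
  "lie_coad n S \<phi> = (\<lambda>Y \<in> carrier_mat n n. - \<phi> (lie_ad S Y))"

definition coadjoint :: "nat \<Rightarrow> 'a::field mat \<Rightarrow> ('a mat \<Rightarrow> 'a) \<Rightarrow> 'a mat \<Rightarrow> 'a" where
  "coadjoint n g \<phi> = (\<lambda>Y \<in> carrier_mat n n. \<phi> (inv\<^bsub>GL n\<^esub> g * Y * g))"

definition nilpotent_mat :: "nat \<Rightarrow> 'a::field mat \<Rightarrow> bool" where
  "nilpotent_mat n X \<longleftrightarrow> X \<in> carrier_mat n n \<and> (\<exists>k. X ^\<^sub>m k = 0\<^sub>m n n)"

definition nilpotent_coadjoint_orbit :: "nat \<Rightarrow> ('a::field mat \<Rightarrow> 'a) set \<Rightarrow> bool" where
  "nilpotent_coadjoint_orbit n Orb \<longleftrightarrow>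
     (\<exists>X. nilpotent_mat n X \<and> Orb = orbit (GL n) (coadjoint n) (trace_form n X))"

definition rational_diagonalizable :: "nat \<Rightarrow> ('a::field_char_0 mat \<Rightarrow> 'a mat) \<Rightarrow> bool" where
  "rational_diagonalizable n T \<longleftrightarrow>
     (\<exists>B. vectorspace.basis class_ring (module_mat TYPE('a) n n) B \<and>
          (\<forall>X \<in> B. \<exists>q::rat. T X = of_rat q \<cdot>\<^sub>m X))"

definition whittaker_pair :: "nat \<Rightarrow> 'a::field_char_0 mat \<Rightarrow> ('a mat \<Rightarrow> 'a) \<Rightarrow> bool" where
  "whittaker_pair n S \<phi> \<longleftrightarrow>
     S \<in> carrier_mat n n \<and> \<phi> \<in> gl_dual n \<and>
     rational_diagonalizable n (lie_ad S) \<and>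
     lie_coad n S \<phi> = (\<lambda>Y \<in> carrier_mat n n. - 2 * \<phi> Y)"

text \<open>\<^const>\<open>jordan_block\<close> is upper triangular, hence the transposition.\<close>

definition nilpotent_jordan_form :: "nat \<Rightarrow> 'a::field mat \<Rightarrow> bool" where
  "nilpotent_jordan_form n J \<longleftrightarrow> J \<in> carrier_mat n n \<and>
     (\<exists>ks. 0 \<notin> set ks \<and> J = diag_block_mat (map (\<lambda>k. transpose_mat (jordan_block k 0)) ks))"

end

theory Submission
  imports Defs
    "Jordan_Normal_Form.Jordan_Normal_Form_Existence"
    "Jordan_Normal_Form.DL_Rank"
begin

text \<open>Ranks of powers are lower semicontinuous, so the Jordan types \<open>N\<close> of the small orbit and
  \<open>M\<close> of the large one satisfy \<open>\<Sum>k\<in>N. max 0 (k - p) \<le> \<Sum>k\<in>M. max 0 (k - p)\<close> for all \<open>p\<close>;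
  this is the dominance order. Conversely, a Jordan form together with a grading by a diagonal
  matrix \<open>S\<close> is a multiset of segments (a start and a length each), and the closure of the
  orbit of the centralizer of \<open>S\<close> allows one to replace a segment and one nested in it by two
  linked segments with the same union and intersection. One therefore looks for positions of the
  parts of \<open>M\<close> from which such moves lead to \<open>N\<close>. Let \<open>L\<close> be the largest part of \<open>N\<close>, and
  \<open>a \<ge> L > b\<close> the parts of \<open>M\<close> next to \<open>L\<close>, where \<open>b = 0\<close> is allowed. Replacing \<open>a, b\<close>
  in \<open>M\<close> by \<open>a + b - L\<close> preserves dominance over \<open>N\<close> without \<open>L\<close>. By induction the new parts can
  be positioned, and the segment of length \<open>a + b - L\<close> together with one of length \<open>L\<close> arises by
  one move from segments of lengths \<open>a\<close> and \<open>b\<close>.\<close>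

section \<open>Partitions\<close>

text \<open>The closure is taken for the centralizer of a single \<open>S\<close>, so no degree can
  be adjusted between two moves. The starts are therefore found backwards: the recursion places the
  parts that remain after \<open>L\<close> is split off, and the start of the segment of length
  \<open>a + b - L\<close> then prescribes those of \<open>a\<close> and \<open>b\<close>. The move
  that creates \<open>L\<close> is carried out first, and \<open>L\<close> is left alone afterwards.
  The maximality of \<open>L\<close> bounds the other parts of \<open>N\<close> in the excess
  estimate, and the choice of \<open>a\<close> and \<open>b\<close> as neighbours keeps the excess
  of the rest of \<open>M\<close> affine between them. On the topological side no norm and no
  sequence is used. A move is a line of matrices whose points off \<open>t = 0\<close> lie in a
  closed set of functionals; the field is not discrete, so the point at \<open>t = 0\<close> lies
  there too. Semicontinuity of the rank rests in the same spirit on one determinant that would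
  vanish on the larger orbit but not at a point of its closure.\<close>

definition excess :: "nat multiset \<Rightarrow> nat \<Rightarrow> nat" where
  "excess M p = (\<Sum>k\<in>#M. k - p)"

lemma excess_simps [simp]:
  "excess {#} p = 0"
  "excess (add_mset k M) p = (k - p) + excess M p"
  "excess (M + N) p = excess M p + excess N p"
  by (auto simp: excess_def)

lemma excess_eq_0: "(\<And>k. k \<in># M \<Longrightarrow> k \<le> p) \<Longrightarrow> excess M p = 0"
  by (induction M) auto

lemma excess_mono: "k \<in># M \<Longrightarrow> k - p \<le> excess M p"
  by (induction M) auto

text \<open>The parts above \<open>p\<close> are the same for all \<open>p\<close> from
  \<open>b\<close> up to \<open>a\<close>, so the excess falls with constant slope, namely their
  number. Each of them is at least \<open>a\<close>, which gives the lower bound.\<close>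

lemma excess_gap:
  assumes "\<And>k. k \<in># M \<Longrightarrow> k \<le> b \<or> a \<le> k" and "b \<le> p" "p < a"
  shows "excess M p + size (filter_mset (\<lambda>k. p < k) M) * (p - b) = excess M b \<and>
         size (filter_mset (\<lambda>k. p < k) M) * (a - p) \<le> excess M p"
  using assms
proof (induction M)
  case (add x M)
  have "x \<le> b \<or> a \<le> x" using add.prems(1)[of x] by simp
  moreover have "excess M p + size (filter_mset (\<lambda>k. p < k) M) * (p - b) = excess M b \<and>
         size (filter_mset (\<lambda>k. p < k) M) * (a - p) \<le> excess M p"
    by (rule add.IH) (use add.prems in auto)
  ultimately show ?case using add.prems(2,3) by auto
qed simp

text \<open>The counterpart without a gap: a part in the interval above \<open>b\<close> and up to
  \<open>p\<close> adds to the excess at \<open>b\<close> but not to the count at \<open>p\<close>,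
  so the affine law weakens to a convexity bound. Each counted part is at most \<open>L\<close>,
  which gives the upper bound.\<close>

lemma excess_slope:
  assumes "\<And>k. k \<in># M \<Longrightarrow> k \<le> L" and "b \<le> p" "p \<le> L"
  shows "excess M p + size (filter_mset (\<lambda>k. p < k) M) * (p - b) \<le> excess M b \<and>
         excess M p \<le> size (filter_mset (\<lambda>k. p < k) M) * (L - p)"
  using assms
proof (induction M)
  case (add x M)
  have "x \<le> L" using add.prems(1)[of x] by simp
  moreover have "excess M p + size (filter_mset (\<lambda>k. p < k) M) * (p - b) \<le> excess M b \<and>
         excess M p \<le> size (filter_mset (\<lambda>k. p < k) M) * (L - p)"
    by (rule add.IH) (use add.prems in auto)
  ultimately show ?case using add.prems(2,3) by auto
qed simp

text \<open>On the interval from \<open>b\<close> to \<open>a\<close> the excess of \<open>M\<close> is affine, whereas that of \<open>N\<close> is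
  convex with integral slopes; this makes the inequality survive at the interior points.\<close>

lemma excess_exchange:
  assumes gap: "\<And>k. k \<in># M \<Longrightarrow> k \<le> b \<or> a \<le> k"
    and le_L: "\<And>k. k \<in># N \<Longrightarrow> k \<le> L"
    and b: "b < L" and a: "L \<le> a"
    and dom: "\<And>p. excess (add_mset L N) p \<le> excess (add_mset a (add_mset b M)) p"
  shows "excess N p \<le> excess (add_mset (a + b - L) M) p"
proof -
  consider "L \<le> p" | "p \<le> b" | "b < p" "p < L" by linarith
  then show ?thesis
  proof cases
    case 1
    then show ?thesis using excess_eq_0[of N p] le_L by fastforce
  next
    case 2
    then show ?thesis using dom[of p] a b by simp
  next
    case 3
    let ?c = "size (filter_mset (\<lambda>k. p < k) M)" and ?s = "size (filter_mset (\<lambda>k. p < k) N)"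
    have M: "excess M p + ?c * (p - b) = excess M b" "?c * (a - p) \<le> excess M p"
      using excess_gap[of M b a p] gap 3 a by auto
    have N: "excess N p + ?s * (p - b) \<le> excess N b" "excess N p \<le> ?s * (L - p)"
      using excess_slope[of N L b p] le_L 3 by auto
    \<comment> \<open>If \<open>N\<close> has at most as many parts above \<open>p\<close> as
      \<open>M\<close>, the bounds that look up to \<open>L\<close> and \<open>a\<close> suffice.
      Otherwise the counts differ by at least 1, so from \<open>b\<close> to \<open>p\<close> the
      excess of \<open>N\<close> loses at least \<open>p - b\<close> more than that of
      \<open>M\<close>; together with dominance at \<open>b\<close> this leaves exactly the term
      \<open>a + b - L - p\<close>.\<close>
    show ?thesis
    proof (cases "?s \<le> ?c")
      case True
      have "excess N p \<le> ?c * (a - p)"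
        by (rule order_trans[OF N(2)]) (use True a in \<open>intro mult_mono; simp\<close>)
      then show ?thesis using M by simp
    next
      case False
      define x y where "x = ?c * (p - b)" and "y = ?s * (p - b)"
      have "(?c + 1) * (p - b) \<le> y"
        unfolding y_def using False by (intro mult_right_mono) auto
      then have "x + (p - b) \<le> y" by (simp add: x_def)
      moreover have "excess N b + (L - b) \<le> excess M b + (a - b)"
        using dom[of b] by simp
      moreover have "excess M p + x = excess M b" "excess N p + y \<le> excess N b"
        using M(1) N(1) by (simp_all add: x_def y_def)
      ultimately show ?thesis using a 3 by simp
    qed
  qed
qed

section \<open>Direct sums and degenerations\<close>

definition direct_sum_mat :: "'a::zero mat \<Rightarrow> 'a mat \<Rightarrow> 'a mat" (infixr "\<boxplus>" 65) where
  "A \<boxplus> B = four_block_mat A (0\<^sub>m (dim_row A) (dim_col B)) (0\<^sub>m (dim_row B) (dim_col A)) B"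

lemma diag_block_mat_Cons: "diag_block_mat (A # As) = A \<boxplus> diag_block_mat As"
  by (simp add: direct_sum_mat_def Let_def)

lemma diag_block_mat_append': "diag_block_mat (As @ Bs) = diag_block_mat As \<boxplus> diag_block_mat Bs"
  by (simp add: direct_sum_mat_def diag_block_mat_append Let_def)

lemma direct_sum_mat_assoc: "(A \<boxplus> B) \<boxplus> C = A \<boxplus> (B \<boxplus> C)"
  unfolding direct_sum_mat_def by (rule assoc_four_block_mat[symmetric])

lemma direct_sum_mat_dim [simp]:
  "dim_row (A \<boxplus> B) = dim_row A + dim_row B" "dim_col (A \<boxplus> B) = dim_col A + dim_col B"
  by (auto simp: direct_sum_mat_def)

lemma direct_sum_mat_carrier [simp, intro]:
  "A \<in> carrier_mat nr nc \<Longrightarrow> B \<in> carrier_mat nr' nc' \<Longrightarrow> A \<boxplus> B \<in> carrier_mat (nr + nr') (nc + nc')"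
  by (intro carrier_matI) auto

lemma direct_sum_mat_index:
  "i < dim_row A + dim_row B \<Longrightarrow> j < dim_col A + dim_col B \<Longrightarrow>
   (A \<boxplus> B) $$ (i, j) =
     (if i < dim_row A then if j < dim_col A then A $$ (i, j) else 0
      else if j < dim_col A then 0 else B $$ (i - dim_row A, j - dim_col A))"
  by (auto simp: direct_sum_mat_def)

lemma direct_sum_mat_mult:
  fixes A :: "'a::semiring_0 mat"
  assumes "A \<in> carrier_mat nr k" "C \<in> carrier_mat k nc" "B \<in> carrier_mat nr' k'" "D \<in> carrier_mat k' nc'"
  shows "(A \<boxplus> B) * (C \<boxplus> D) = (A * C) \<boxplus> (B * D)"
proof -
  have "four_block_mat A (0\<^sub>m nr k') (0\<^sub>m nr' k) B * four_block_mat C (0\<^sub>m k nc') (0\<^sub>m k' nc) D =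
        four_block_mat (A * C) (0\<^sub>m nr nc') (0\<^sub>m nr' nc) (B * D)"
    by (subst mult_four_block_mat[of _ nr k _ k' _ nr' _ _ nc _ nc']) (use assms in auto)
  then show ?thesis using assms by (simp add: direct_sum_mat_def)
qed

lemma direct_sum_mat_add:
  fixes A :: "'a::monoid_add mat"
  assumes "A \<in> carrier_mat nr nc" "C \<in> carrier_mat nr nc" "B \<in> carrier_mat nr' nc'" "D \<in> carrier_mat nr' nc'"
  shows "(A \<boxplus> B) + (C \<boxplus> D) = (A + C) \<boxplus> (B + D)"
  by (rule eq_matI) (use assms in \<open>auto simp: direct_sum_mat_index\<close>)

lemma direct_sum_mat_smult:
  fixes A :: "'a::mult_zero mat"
  shows "c \<cdot>\<^sub>m (A \<boxplus> B) = (c \<cdot>\<^sub>m A) \<boxplus> (c \<cdot>\<^sub>m B)"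
  by (rule eq_matI) (auto simp: direct_sum_mat_index)

lemma direct_sum_mat_one: "1\<^sub>m m \<boxplus> 1\<^sub>m n = 1\<^sub>m (m + n)"
  by (rule eq_matI) (auto simp: direct_sum_mat_index)

lemma direct_sum_mat_empty: "dim_row A = 0 \<Longrightarrow> dim_col A = 0 \<Longrightarrow> A \<boxplus> B = B"
  by (rule eq_matI) (auto simp: direct_sum_mat_index)

lemma direct_sum_mat_pow:
  fixes A :: "'a::semiring_1 mat"
  assumes "A \<in> carrier_mat m m" "B \<in> carrier_mat n n"
  shows "(A \<boxplus> B) ^\<^sub>m k = A ^\<^sub>m k \<boxplus> B ^\<^sub>m k"
proof (induction k)
  case 0
  then show ?case using assms by (simp add: direct_sum_mat_one carrier_matD)
next
  case (Suc k)
  then show ?case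
    using assms by (simp add: direct_sum_mat_mult[of _ m m _ m _ n n _ n] pow_carrier_mat)
qed

text \<open>The inverse is carried as an explicit witness; \<open>GL_inverse\<close> identifies it
  with the inverse in the group \<open>GL n\<close>.\<close>

definition mat_conjugator :: "nat \<Rightarrow> 'a::field mat \<Rightarrow> 'a mat \<Rightarrow> bool" where
  "mat_conjugator n P Q \<longleftrightarrow>
     P \<in> carrier_mat n n \<and> Q \<in> carrier_mat n n \<and> P * Q = 1\<^sub>m n \<and> Q * P = 1\<^sub>m n"

lemma mat_conjugator_direct_sum:
  "mat_conjugator n P Q \<Longrightarrow> mat_conjugator m P' Q' \<Longrightarrow>
   mat_conjugator (n + m) (P \<boxplus> P') (Q \<boxplus> Q')"
  unfolding mat_conjugator_def
  by (auto simp: direct_sum_mat_mult[of _ n n _ n _ m m _ m] direct_sum_mat_one)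

lemma mat_conjugator_one: "mat_conjugator n (1\<^sub>m n) (1\<^sub>m n)"
  by (auto simp: mat_conjugator_def)

text \<open>\<open>(S', X')\<close> is the limit at \<open>t = 0\<close> of conjugates of \<open>(S, X)\<close> whose first component is \<open>S'\<close>.
  Stated on a punctured line, this implies membership in the closure of an orbit of the centralizer
  but needs no topology.\<close>

definition one_step_degenerates ::
  "nat \<Rightarrow> 'a::field mat \<Rightarrow> 'a mat \<Rightarrow> 'a mat \<Rightarrow> 'a mat \<Rightarrow> bool" where
  "one_step_degenerates n S X S' X' \<longleftrightarrow>
     {S, X, S', X'} \<subseteq> carrier_mat n n \<and>
     (\<exists>E\<in>carrier_mat n n. \<forall>t. t \<noteq> 0 \<longrightarrow>
        (\<exists>P Q. mat_conjugator n P Q \<and> P * S = S' * P \<and> P * X = (X' + t \<cdot>\<^sub>m E) * P))"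

text \<open>The source pair is a parameter and steps are appended at the end, because the closure
  argument keeps the orbit of the source fixed while the target moves.\<close>

inductive degenerates ::
  "nat \<Rightarrow> 'a::field mat \<Rightarrow> 'a mat \<Rightarrow> 'a mat \<Rightarrow> 'a mat \<Rightarrow> bool" for n S X where
  refl: "S \<in> carrier_mat n n \<Longrightarrow> X \<in> carrier_mat n n \<Longrightarrow> degenerates n S X S X"
| step: "degenerates n S X S' X' \<Longrightarrow> one_step_degenerates n S' X' S'' X'' \<Longrightarrow>
         degenerates n S X S'' X''"

lemma one_step_degenerates_carrier:
  "one_step_degenerates n S X S' X' \<Longrightarrow> {S, X, S', X'} \<subseteq> carrier_mat n n"
  unfolding one_step_degenerates_def by (elim conjE)

lemma degenerates_carrier:
  "degenerates n S X S' X' \<Longrightarrow> {S, X, S', X'} \<subseteq> carrier_mat n n"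
  by (induction rule: degenerates.induct) (auto dest: one_step_degenerates_carrier)

lemma degenerates_trans:
  assumes "degenerates n S' X' S'' X''" "degenerates n S X S' X'"
  shows "degenerates n S X S'' X''"
  using assms
proof (induction rule: degenerates.induct)
  case (step S' X' S'' X'')
  then show ?case using degenerates.step by blast
qed

lemma one_step_degenerates_imp: "one_step_degenerates n S X S' X' \<Longrightarrow> degenerates n S X S' X'"
  by (rule degenerates.step[OF degenerates.refl]) (auto dest: one_step_degenerates_carrier)

text \<open>The constant family \<open>E = 0\<close>. Simultaneous conjugation has to count as a
  degeneration, since reordering blocks changes the matrix \<open>S\<close>.\<close>

lemma conjugate_imp_degenerates:
  assumes "{S, X, S', X'} \<subseteq> carrier_mat n n" "mat_conjugator n P Q" "P * S = S' * P" "P * X = X' * P"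
  shows "degenerates n S X S' X'"
proof (rule one_step_degenerates_imp)
  have "X' + t \<cdot>\<^sub>m 0\<^sub>m n n = X'" for t using assms by auto
  then show "one_step_degenerates n S X S' X'"
    unfolding one_step_degenerates_def using assms by (intro conjI bexI[of _ "0\<^sub>m n n"]) auto
qed

lemma one_step_degenerates_direct_sum:
  assumes "one_step_degenerates n S X S' X'" and AB: "A \<in> carrier_mat m m" "B \<in> carrier_mat m m"
  shows "one_step_degenerates (n + m) (S \<boxplus> A) (X \<boxplus> B) (S' \<boxplus> A) (X' \<boxplus> B)"
proof -
  obtain E where E: "E \<in> carrier_mat n n"
    and PQ: "\<And>t. t \<noteq> 0 \<Longrightarrow> \<exists>P Q. mat_conjugator n P Q \<and> P * S = S' * P \<and> P * X = (X' + t \<cdot>\<^sub>m E) * P"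
    and car: "S \<in> carrier_mat n n" "X \<in> carrier_mat n n" "S' \<in> carrier_mat n n" "X' \<in> carrier_mat n n"
    using assms unfolding one_step_degenerates_def by auto
  have "\<exists>P Q. mat_conjugator (n + m) P Q \<and> P * (S \<boxplus> A) = (S' \<boxplus> A) * P \<and>
          P * (X \<boxplus> B) = ((X' \<boxplus> B) + t \<cdot>\<^sub>m (E \<boxplus> 0\<^sub>m m m)) * P" if t: "t \<noteq> 0" for t
  proof -
    from PQ[OF t] obtain P Q where P: "mat_conjugator n P Q" "P * S = S' * P"
      "P * X = (X' + t \<cdot>\<^sub>m E) * P" by auto
    have "mat_conjugator (n + m) (P \<boxplus> 1\<^sub>m m) (Q \<boxplus> 1\<^sub>m m)"
      using P mat_conjugator_one mat_conjugator_direct_sum by blast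
    moreover have "(X' \<boxplus> B) + t \<cdot>\<^sub>m (E \<boxplus> 0\<^sub>m m m) = (X' + t \<cdot>\<^sub>m E) \<boxplus> B"
      using E car AB by (simp add: direct_sum_mat_smult direct_sum_mat_add[of _ n n _ _ m m])
    moreover have "P \<in> carrier_mat n n" using P by (auto simp: mat_conjugator_def)
    ultimately show ?thesis using P E car AB
      by (intro exI[of _ "P \<boxplus> 1\<^sub>m m"] exI[of _ "Q \<boxplus> 1\<^sub>m m"])
        (simp add: direct_sum_mat_mult[of _ n n _ n _ m m _ m])
  qed
  then show ?thesis
    unfolding one_step_degenerates_def using car AB E
    by (intro conjI bexI[of _ "E \<boxplus> 0\<^sub>m m m"]) auto
qed

lemma degenerates_direct_sum:
  assumes "degenerates n S X S' X'" and "A \<in> carrier_mat m m" "B \<in> carrier_mat m m"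
  shows "degenerates (n + m) (S \<boxplus> A) (X \<boxplus> B) (S' \<boxplus> A) (X' \<boxplus> B)"
  using assms(1)
proof (induction rule: degenerates.induct)
  case refl
  then show ?case using assms by (intro degenerates.refl) auto
next
  case (step S' X' S'' X'')
  then show ?case
    using degenerates.step one_step_degenerates_direct_sum assms by blast
qed

text \<open>The block permutation depends only on the sizes, so the same conjugation swaps the
  gradings and the nilpotents.\<close>

lemma direct_sum_swap_conjugator:
  "\<exists>P Q :: 'a::field mat. mat_conjugator (m + n) P Q \<and>
     (\<forall>A\<in>carrier_mat m m. \<forall>B\<in>carrier_mat n n. P * (A \<boxplus> B) = (B \<boxplus> A) * P)"
proof (intro exI conjI ballI)
  define W :: "nat \<Rightarrow> nat \<Rightarrow> 'a mat"
    where "W m n = four_block_mat (0\<^sub>m n m) (1\<^sub>m n) (1\<^sub>m m) (0\<^sub>m m n)" for m n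
  have WW: "W n m * W m n = 1\<^sub>m (m + n)" for m n
    unfolding W_def
    by (subst mult_four_block_mat[of _ m n _ m _ n _ _ m _ n]) auto
  show "mat_conjugator (m + n) (W m n) (W n m)"
    unfolding mat_conjugator_def
    using WW[of n m] WW[of m n] by (auto simp: W_def add.commute)
  fix A B :: "'a mat" assume A: "A \<in> carrier_mat m m" and B: "B \<in> carrier_mat n n"
  have "W m n * (A \<boxplus> B) = four_block_mat (0\<^sub>m n m) B A (0\<^sub>m m n)"
    unfolding W_def direct_sum_mat_def
    by (subst mult_four_block_mat[of _ n m _ n _ m _ _ m _ n]) (use A B in auto)
  moreover have "(B \<boxplus> A) * W m n = four_block_mat (0\<^sub>m n m) B A (0\<^sub>m m n)"
    unfolding W_def direct_sum_mat_def
    by (subst mult_four_block_mat[of _ n n _ m _ m _ _ m _ n]) (use A B in auto)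
  ultimately show "W m n * (A \<boxplus> B) = (B \<boxplus> A) * W m n" by simp
qed

lemma direct_sum_swap:
  fixes A :: "'a::field mat"
  assumes "A \<in> carrier_mat m m" "B \<in> carrier_mat n n" "X \<in> carrier_mat m m" "Y \<in> carrier_mat n n"
  shows "degenerates (m + n) (A \<boxplus> B) (X \<boxplus> Y) (B \<boxplus> A) (Y \<boxplus> X)"
proof -
  obtain P Q :: "'a mat" where PQ: "mat_conjugator (m + n) P Q"
    and comm: "P * (A \<boxplus> B) = (B \<boxplus> A) * P" "P * (X \<boxplus> Y) = (Y \<boxplus> X) * P"
    using direct_sum_swap_conjugator[of m n] assms by blast
  have "B \<boxplus> A \<in> carrier_mat (m + n) (m + n)" "Y \<boxplus> X \<in> carrier_mat (m + n) (m + n)"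
    using assms direct_sum_mat_carrier[of _ n n _ m m] by (simp_all add: add.commute)
  then show ?thesis using assms by (intro conjugate_imp_degenerates[OF _ PQ comm]) auto
qed

section \<open>Graded chains\<close>

text \<open>A pair \<open>(c, k)\<close> is a Jordan chain of length \<open>k\<close> whose vectors have degrees \<open>c\<close> to \<open>c + k - 1\<close>.
  The factor \<open>-2\<close> in the grading makes the nilpotent an eigenvector of eigenvalue \<open>-2\<close>.\<close>

definition segment_grading :: "(int \<times> nat) list \<Rightarrow> 'a::field_char_0 mat" where
  "segment_grading segs = diag_block_mat
     (map (\<lambda>(c, k). mat k k (\<lambda>(i, j). if i = j then of_int (- 2 * (c + int i)) else 0)) segs)"

definition segment_jordan :: "(int \<times> nat) list \<Rightarrow> 'a::field_char_0 mat" where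
  "segment_jordan segs = diag_block_mat (map (\<lambda>(c, k). transpose_mat (jordan_block k 0)) segs)"

definition segment_size :: "(int \<times> nat) list \<Rightarrow> nat" where
  "segment_size segs = sum_list (map snd segs)"

lemma segment_size_simps [simp]:
  "segment_size [] = 0" "segment_size (x # segs) = snd x + segment_size segs"
  "segment_size (segs @ segs') = segment_size segs + segment_size segs'"
  by (auto simp: segment_size_def)

lemma segment_append:
  "segment_grading (s @ s') = segment_grading s \<boxplus> segment_grading s'"
  "segment_jordan (s @ s') = segment_jordan s \<boxplus> segment_jordan s'"
  by (auto simp: segment_grading_def segment_jordan_def diag_block_mat_append')

lemma segment_carrier [simp, intro]:
  "segment_grading s \<in> carrier_mat (segment_size s) (segment_size s)"
  "segment_jordan s \<in> carrier_mat (segment_size s) (segment_size s)"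
  by (auto simp: segment_grading_def segment_jordan_def segment_size_def dim_diag_block_mat o_def
      split_beta intro!: carrier_matI)

lemma segment_Cons:
  "segment_grading (x # s) = segment_grading [x] \<boxplus> segment_grading s"
  "segment_jordan (x # s) = segment_jordan [x] \<boxplus> segment_jordan s"
  using segment_append[of "[x]" s] by auto

lemma segment_single_index:
  assumes "i < k" "j < k"
  shows "segment_grading [(c, k)] $$ (i, j) = (if i = j then of_int (- 2 * (c + int i)) else 0)"
    and "segment_jordan [(c, k)] $$ (i, j) = (if i = Suc j then 1 else 0)"
  using assms by (auto simp: segment_grading_def segment_jordan_def)

lemma segment_dim [simp]:
  "dim_row (segment_grading s) = segment_size s" "dim_col (segment_grading s) = segment_size s"
  "dim_row (segment_jordan s) = segment_size s" "dim_col (segment_jordan s) = segment_size s"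
  using segment_carrier[of s] by (auto simp del: segment_carrier)

lemma segment_pair_index:
  assumes "i < a + b" "j < a + b"
  shows "segment_grading [(c, a), (d, b)] $$ (i, j) =
           (if i = j then of_int (- 2 * (if i < a then c + int i else d + int i - int a)) else 0)"
    and "segment_jordan [(c, a), (d, b)] $$ (i, j) = (if i = Suc j \<and> i \<noteq> a then 1 else 0)"
  unfolding segment_Cons[of "(c, a)" "[(d, b)]"] using assms
  by (auto simp: direct_sum_mat_index segment_single_index of_nat_diff)

text \<open>Segments of length 0 realize the value \<open>b = 0\<close>; they leave no trace in the
  matrices and can be inserted or removed freely.\<close>

lemma segment_drop_empty:
  "segment_grading ((c, 0) # s) = segment_grading s"
  "segment_jordan ((c, 0) # s) = segment_jordan s"
  unfolding segment_Cons[of "(c, 0)" s] by (simp_all add: direct_sum_mat_empty)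

text \<open>The type argument fixes the field, which does not occur in the lists of
  segments.\<close>

definition segments_degenerate ::
  "'a::field_char_0 itself \<Rightarrow> (int \<times> nat) list \<Rightarrow> (int \<times> nat) list \<Rightarrow> bool" where
  "segments_degenerate _ s s' \<longleftrightarrow>
     degenerates (segment_size s) (segment_grading s :: 'a mat) (segment_jordan s)
       (segment_grading s') (segment_jordan s')"

lemma segments_degenerate_size:
  assumes "segments_degenerate TYPE('a::field_char_0) s s'"
  shows "segment_size s' = segment_size s"
proof -
  have "dim_row (segment_grading s' :: 'a mat) = segment_size s"
    using degenerates_carrier[OF assms[unfolded segments_degenerate_def]]
    by (auto simp del: segment_carrier segment_dim)
  then show ?thesis by simp
qed

lemma segments_degenerate_refl: "segments_degenerate TYPE('a::field_char_0) s s"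
  unfolding segments_degenerate_def by (rule degenerates.refl) (rule segment_carrier)+

lemma segments_degenerate_trans:
  assumes 1: "segments_degenerate TYPE('a::field_char_0) s s'"
    and 2: "segments_degenerate TYPE('a) s' s''"
  shows "segments_degenerate TYPE('a) s s''"
  using degenerates_trans 1 2 segments_degenerate_size[OF 1]
  unfolding segments_degenerate_def by metis

lemma segments_degenerate_append:
  assumes "segments_degenerate TYPE('a::field_char_0) s s'"
  shows "segments_degenerate TYPE('a) (s @ r) (s' @ r)"
  using degenerates_direct_sum[OF assms[unfolded segments_degenerate_def],
      of "segment_grading r" "segment_size r" "segment_jordan r"]
  by (simp add: segment_append segments_degenerate_def)

lemma segments_degenerate_swap: "segments_degenerate TYPE('a::field_char_0) (s @ s') (s' @ s)"
  using direct_sum_swap[of "segment_grading s :: 'a mat" "segment_size s" "segment_grading s'"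
      "segment_size s'" "segment_jordan s" "segment_jordan s'"]
  by (simp add: segment_append segments_degenerate_def)

lemma segments_degenerate_prepend:
  assumes "segments_degenerate TYPE('a::field_char_0) s s'"
  shows "segments_degenerate TYPE('a) (r @ s) (r @ s')"
  using segments_degenerate_swap segments_degenerate_append[OF assms] segments_degenerate_trans
  by metis

text \<open>Rotations suffice: one swap brings the head of \<open>s'\<close> to the front, and the
  induction continues behind it.\<close>

lemma segments_degenerate_mset:
  "mset s = mset s' \<Longrightarrow> segments_degenerate TYPE('a::field_char_0) s s'"
proof (induction s' arbitrary: s)
  case Nil
  then show ?case by (simp add: segments_degenerate_refl)
next
  case (Cons x s')
  then obtain xs ys where s: "s = xs @ x # ys"
    by (metis list.set_intros(1) mset_eq_setD split_list)
  then have "mset (ys @ xs) = mset s'" using Cons.prems by (auto simp: add.commute)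
  then have "segments_degenerate TYPE('a) ([x] @ (ys @ xs)) ([x] @ s')"
    by (intro segments_degenerate_prepend Cons.IH)
  moreover have "segments_degenerate TYPE('a) (xs @ (x # ys)) ((x # ys) @ xs)"
    by (rule segments_degenerate_swap)
  ultimately show ?case using segments_degenerate_trans by (simp add: s) blast
qed

section \<open>The elementary move on two nested segments\<close>

lemma index_mult_mat_sum:
  "A \<in> carrier_mat nr n \<Longrightarrow> B \<in> carrier_mat n nc \<Longrightarrow> i < nr \<Longrightarrow> j < nc \<Longrightarrow>
   (A * B) $$ (i, j) = (\<Sum>k<n. A $$ (i, k) * B $$ (k, j))"
  by (auto simp: scalar_prod_def atLeast0LessThan)

text \<open>Write \<open>f\<close> and \<open>e\<close> for the two chains of lengths \<open>b + w\<close> and \<open>b + u\<close>. Adding the arrow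
  that sends the last \<open>e\<close> to \<open>t\<close> times \<open>f\<^sub>b\<close> prolongs the chain \<open>e\<close> to length \<open>b + u + w\<close>, and
  the vectors \<open>f\<^sub>i - e\<^sub>u\<^sub>+\<^sub>i / t\<close> for \<open>i < b\<close> form a complementary chain. These are the columns
  of \<open>P\<close>.\<close>

lemma segments_degenerate_pair:
  assumes u: "0 < b + u" and w: "0 < w"
  shows "segments_degenerate TYPE('a::field_char_0)
           [(c, b + u + w), (c + int u, b)] [(c + int u, b + w), (c, b + u)]"
proof -
  define n where "n = b + u + w + b"
  have n: "0 < n" using w by (simp add: n_def)
  let ?S = "segment_grading [(c, b + u + w), (c + int u, b)] :: 'a mat"
  let ?X = "segment_jordan [(c, b + u + w), (c + int u, b)] :: 'a mat"
  let ?S' = "segment_grading [(c + int u, b + w), (c, b + u)] :: 'a mat"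
  let ?X' = "segment_jordan [(c + int u, b + w), (c, b + u)] :: 'a mat"
  have car: "?S \<in> carrier_mat n n" "?X \<in> carrier_mat n n" "?S' \<in> carrier_mat n n" "?X' \<in> carrier_mat n n"
    by (auto simp: n_def intro!: carrier_matI)
  \<comment> \<open>In the basis of \<open>?X'\<close> the chain \<open>f\<close> comes first, so
    row \<open>b\<close> is \<open>f_b\<close> and column \<open>n - 1\<close> is the last
    \<open>e\<close>. Their degrees are \<open>c + u + b\<close> and \<open>c + b + u - 1\<close>,
    so the arrow raises the degree by one as the other arrows do. Both vectors exist because
    \<open>w\<close> and \<open>b + u\<close> are positive.\<close>
  define E :: "'a mat" where "E = mat n n (\<lambda>(r, k). if r = b \<and> k = n - 1 then 1 else 0)"
  have E: "E \<in> carrier_mat n n" by (auto simp: E_def)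
  have "\<exists>P Q. mat_conjugator n P Q \<and> P * ?S = ?S' * P \<and> P * ?X = (?X' + t \<cdot>\<^sub>m E) * P"
    if t: "t \<noteq> 0" for t :: 'a
  proof -
    \<comment> \<open>In the last branch \<open>j = b + u + w + i\<close>, and the vector
      \<open>e_(u+i)\<close> has position \<open>b + w + (u + i)\<close>, which is \<open>j\<close>
      itself; hence the condition \<open>r = j\<close>.\<close>
    define p :: "nat \<Rightarrow> nat \<Rightarrow> 'a" where "p r j =
      (if j < b + u then if r = b + w + j then 1 else 0
       else if j < b + u + w then if r + u = j then t else 0
       else (if r + b + u + w = j then 1 else 0) - (if r = j then inverse t else 0))" for r j
    \<comment> \<open>Solving for the old basis: \<open>e_j\<close> is column \<open>j\<close>,
      while \<open>f_r\<close> is column \<open>b + u + w + r\<close> plus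
      \<open>e_(u+r) / t\<close> for \<open>r < b\<close>, and column \<open>u + r\<close> divided
      by \<open>t\<close> for \<open>r \<ge> b\<close>. So a row of the inverse has at most two
      entries, at \<open>q1 i\<close> and \<open>q2 i\<close>; where the second is absent,
      \<open>q2 i = 0\<close> is a placeholder with coefficient 0.\<close>
    define q1 where "q1 i = (if i < b + u then b + w + i else if i < b + u + w then i - u
       else i - (b + u + w))" for i
    define q2 where "q2 i = (if i < b + u then i - u else 0)" for i
    define Q :: "'a mat" where "Q = mat n n (\<lambda>(i, r).
        (if r = q1 i then if b + u \<le> i \<and> i < b + u + w then inverse t else 1 else 0) +
        (if r = q2 i then if i < b + u \<and> u \<le> i then inverse t else 0 else 0))"
    define P where "P = mat n n (\<lambda>(r, j). p r j)"
    have P: "P \<in> carrier_mat n n" and Q: "Q \<in> carrier_mat n n" by (auto simp: P_def Q_def)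
    have "P * ?S = ?S' * P"
    proof (rule eq_matI)
      fix r j assume "r < dim_row (?S' * P)" "j < dim_col (?S' * P)"
      then have rj: "r < n" "j < n" using car P by auto
      have "(P * ?S) $$ (r, j) = (\<Sum>k<n. p r k * ?S $$ (k, j))"
        using rj by (subst index_mult_mat_sum[OF P car(1)]) (auto simp: P_def)
      also have "\<dots> = (\<Sum>k<n. if k = j then p r j * ?S $$ (j, j) else 0)"
        using rj by (intro sum.cong) (auto simp: segment_pair_index n_def)
      also have "\<dots> = p r j * ?S $$ (j, j)" using rj by simp
      also have "\<dots> = ?S' $$ (r, r) * p r j"
      proof (cases "p r j = 0")
        case False
        then show ?thesis
          using rj by (auto simp: segment_pair_index n_def p_def split: if_splits)
      qed simp
      also have "\<dots> = (\<Sum>k<n. if k = r then ?S' $$ (r, r) * p r j else 0)" using rj by simp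
      also have "\<dots> = (\<Sum>k<n. ?S' $$ (r, k) * p k j)"
        using rj by (intro sum.cong) (auto simp: segment_pair_index n_def)
      also have "\<dots> = (?S' * P) $$ (r, j)"
        using rj by (subst index_mult_mat_sum[OF car(3) P]) (auto simp: P_def)
      finally show "(P * ?S) $$ (r, j) = (?S' * P) $$ (r, j)" .
    qed (use car P in auto)
    moreover have "P * ?X = (?X' + t \<cdot>\<^sub>m E) * P"
    proof (rule eq_matI)
      have car': "?X' + t \<cdot>\<^sub>m E \<in> carrier_mat n n" using car E by auto
      fix r j assume "r < dim_row ((?X' + t \<cdot>\<^sub>m E) * P)" "j < dim_col ((?X' + t \<cdot>\<^sub>m E) * P)"
      then have rj: "r < n" "j < n" using E car P by auto
      have "(P * ?X) $$ (r, j) = (\<Sum>k<n. p r k * ?X $$ (k, j))"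
        using rj by (subst index_mult_mat_sum[OF P car(2)]) (auto simp: P_def)
      also have "\<dots> = (\<Sum>k<n. if k = Suc j then if Suc j = b + u + w then 0 else p r (Suc j) else 0)"
        using rj by (intro sum.cong) (auto simp: segment_pair_index n_def)
      also have "\<dots> = (if Suc j < n \<and> Suc j \<noteq> b + u + w then p r (Suc j) else 0)" by simp
      \<comment> \<open>The cases are the interiors and the ends of the three groups of columns. At
        the end of the \<open>e\<close> group the arrow \<open>t E\<close> produces
        \<open>t f_b\<close>. At the end of the complementary chain \<open>?X'\<close> sends
        \<open>f_(b-1)\<close> to \<open>f_b\<close> and \<open>t E\<close> sends
        \<open>- e_(b+u-1) / t\<close> to \<open>- f_b\<close>; they cancel, so this chain stops
        after \<open>b\<close> vectors.\<close>
      also have "\<dots> = (if r \<noteq> 0 \<and> r \<noteq> b + w then p (r - 1) j else 0) +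
                     (if r = b then t * p (n - 1) j else 0)"
      proof -
        consider "Suc j < b + u" | "Suc j = b + u" | "b + u \<le> j" "Suc j < b + u + w" |
          "b + u \<le> j" "Suc j = b + u + w" | "b + u + w \<le> j" "Suc j < n" | "b + u + w \<le> j" "Suc j = n"
          using rj w by linarith
        then show ?thesis
          using rj t w u unfolding n_def by cases (cases r; simp add: p_def; linarith?)+
      qed
      also have "\<dots> = (\<Sum>k<n. (if k = r - 1 then if r \<noteq> 0 \<and> r \<noteq> b + w then p (r - 1) j else 0 else 0) +
                     (if k = n - 1 then if r = b then t * p (n - 1) j else 0 else 0))"
        using rj by (simp add: sum.distrib)
      also have "\<dots> = (\<Sum>k<n. (?X' + t \<cdot>\<^sub>m E) $$ (r, k) * p k j)"
      proof (rule sum.cong)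
        fix k assume "k \<in> {..<n}"
        then have k: "k < n" by simp
        have "?X' $$ (r, k) = (if r = Suc k \<and> r \<noteq> b + w then 1 else 0)"
          using rj k by (intro segment_pair_index) (auto simp: n_def)
        then have "(?X' + t \<cdot>\<^sub>m E) $$ (r, k) =
            (if r = Suc k \<and> r \<noteq> b + w then 1 else 0) + (if r = b \<and> k = n - 1 then t else 0)"
          using rj k E car by (simp add: E_def)
        then show "(if k = r - 1 then if r \<noteq> 0 \<and> r \<noteq> b + w then p (r - 1) j else 0 else 0) +
            (if k = n - 1 then if r = b then t * p (n - 1) j else 0 else 0) =
            (?X' + t \<cdot>\<^sub>m E) $$ (r, k) * p k j"
          by (cases r) (auto simp: distrib_right)
      qed simp
      also have "\<dots> = ((?X' + t \<cdot>\<^sub>m E) * P) $$ (r, j)"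
        using rj by (subst index_mult_mat_sum[OF car' P]) (auto simp: P_def)
      finally show "(P * ?X) $$ (r, j) = ((?X' + t \<cdot>\<^sub>m E) * P) $$ (r, j)" .
    qed (use car P E in auto)
    moreover have QP: "Q * P = 1\<^sub>m n"
    proof (rule eq_matI)
      fix i j assume "i < dim_row (1\<^sub>m n)" "j < dim_col (1\<^sub>m n)"
      then have ij: "i < n" "j < n" by auto
      have q: "q1 i < n" "q2 i < n" using ij n by (auto simp: q1_def q2_def n_def)
      have "(Q * P) $$ (i, j) = (\<Sum>r<n.
          (if r = q1 i then (if b + u \<le> i \<and> i < b + u + w then inverse t else 1) * p (q1 i) j else 0) +
          (if r = q2 i then (if i < b + u \<and> u \<le> i then inverse t else 0) * p (q2 i) j else 0))"
        using ij unfolding index_mult_mat_sum[OF Q P ij]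
        by (intro sum.cong) (simp_all add: P_def Q_def distrib_right)
      also have "\<dots> = (if b + u \<le> i \<and> i < b + u + w then inverse t else 1) * p (q1 i) j +
          (if i < b + u \<and> u \<le> i then inverse t else 0) * p (q2 i) j"
        using q by (simp add: sum.distrib)
      also have "\<dots> = (if i = j then 1 else 0)"
      proof -
        consider "i < b + u" "u \<le> i" | "i < b + u" "i < u" | "b + u \<le> i" "i < b + u + w" | "b + u + w \<le> i"
          by linarith
        then show ?thesis
          using ij t w unfolding n_def by cases (auto simp: p_def q1_def q2_def)
      qed
      finally show "(Q * P) $$ (i, j) = 1\<^sub>m n $$ (i, j)" using ij by simp
    qed (use P Q in auto)
    moreover have "P * Q = 1\<^sub>m n" using mat_mult_left_right_inverse[OF Q P QP] .
    ultimately show ?thesis using P Q by (auto simp: mat_conjugator_def)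
  qed
  then have "one_step_degenerates n ?S ?X ?S' ?X'"
    unfolding one_step_degenerates_def using E car by auto
  then show ?thesis
    unfolding segments_degenerate_def
    using one_step_degenerates_imp by (simp add: n_def add.assoc)
qed

text \<open>The hypothesis already places a segment of length \<open>a + b - L\<close>, starting at
  some \<open>c\<close>. Put \<open>a\<close> at the same start and \<open>b\<close> at
  \<open>c + (a - L)\<close>: their move returns that segment together with one of length
  \<open>L\<close> that starts where \<open>b\<close> does and ends where \<open>a\<close> does. The
  latter is then carried along unchanged.\<close>

lemma exists_segments_step:
  assumes IH: "\<exists>segs tsegs. mset (map snd segs) = add_mset (a + b - L) M \<and> mset (map snd tsegs) = N \<and>
      segments_degenerate TYPE('a::field_char_0) segs tsegs"
    and b: "b < L" and a: "L \<le> a"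
  shows "\<exists>segs tsegs. mset (map snd segs) = add_mset a (add_mset b M) \<and>
      mset (map snd tsegs) = add_mset L N \<and> segments_degenerate TYPE('a) segs tsegs"
proof -
  obtain w u where L: "L = b + w" "a = L + u" and w: "0 < w"
    using b a by (metis le_add_diff_inverse less_imp_le zero_less_diff)
  then have m: "a + b - L = b + u" by simp
  obtain segs tsegs where segs: "mset (map snd segs) = add_mset (b + u) M"
    and tsegs: "mset (map snd tsegs) = N" and deg: "segments_degenerate TYPE('a) segs tsegs"
    using IH unfolding m by blast
  have "b + u \<in> set (map snd segs)" using segs by (metis set_mset_mset union_single_eq_member)
  then obtain c where "(c, b + u) \<in> set segs" by auto
  then obtain rest where rest: "mset segs = mset ((c, b + u) # rest)"
    by (metis in_set_conv_decomp_first mset.simps(2) mset_append union_mset_add_mset_right)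
  define s1 where "s1 = [(c, b + u + w), (c + int u, b)] @ rest"
  define s2 where "s2 = [(c + int u, b + w), (c, b + u)] @ rest"
  have "segments_degenerate TYPE('a) s1 s2"
  proof (cases "b + u = 0")
    \<comment> \<open>Here \<open>b = 0\<close> and \<open>a = L\<close>, so there is nothing to
      move.\<close>
    case True
    then have "s1 = s2" by (simp add: s1_def s2_def)
    then show ?thesis by (simp add: segments_degenerate_refl)
  next
    case False
    then show ?thesis
      unfolding s1_def s2_def using w
      by (intro segments_degenerate_append segments_degenerate_pair) auto
  qed
  moreover have "segments_degenerate TYPE('a) s2 ([(c + int u, b + w)] @ segs)"
    by (rule segments_degenerate_mset) (use rest in \<open>simp add: s2_def\<close>)
  moreover have "segments_degenerate TYPE('a) ([(c + int u, b + w)] @ segs) ([(c + int u, b + w)] @ tsegs)"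
    by (rule segments_degenerate_prepend[OF deg])
  ultimately have "segments_degenerate TYPE('a) s1 ([(c + int u, b + w)] @ tsegs)"
    using segments_degenerate_trans by blast
  moreover have "mset (map snd s1) = add_mset a (add_mset b M)"
  proof -
    have "mset (map snd segs) = mset (map snd ((c, b + u) # rest))"
      using rest by (metis mset_map)
    then have "mset (map snd rest) = M" using segs by simp
    then show ?thesis using L by (simp add: s1_def ac_simps)
  qed
  moreover have "mset (map snd ([(c + int u, b + w)] @ tsegs)) = add_mset L N"
    using tsegs L by simp
  ultimately show ?thesis by blast
qed

lemma exists_segments:
  assumes "0 \<notin># N" and "\<And>p. excess N p \<le> excess M p" and "excess N 0 = excess M 0"
  shows "\<exists>segs tsegs. mset (map snd segs) = M \<and> mset (map snd tsegs) = N \<and>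
      segments_degenerate TYPE('a::field_char_0) segs tsegs"
proof -
  \<comment> \<open>Undoes the padding of \<open>M\<close> by a zero part, which is needed when no
    part of \<open>M\<close> lies below \<open>L\<close>.\<close>
  have drop: "\<exists>segs tsegs. mset (map snd segs) = M \<and> mset (map snd tsegs) = N \<and>
      segments_degenerate TYPE('a) segs tsegs"
    if zero: "\<exists>segs tsegs. mset (map snd segs) = add_mset 0 M \<and> mset (map snd tsegs) = N \<and>
      segments_degenerate TYPE('a) segs tsegs" for M N
  proof -
    obtain segs tsegs where segs: "mset (map snd segs) = add_mset 0 M"
      and tsegs: "mset (map snd tsegs) = N" and deg: "segments_degenerate TYPE('a) segs tsegs"
      using zero by blast
    have "0 \<in> set (map snd segs)" using segs by (metis set_mset_mset union_single_eq_member)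
    then obtain c where "(c, 0) \<in> set segs" by auto
    then obtain rest where rest: "mset segs = mset ((c, 0) # rest)"
      by (metis in_set_conv_decomp_first mset.simps(2) mset_append union_mset_add_mset_right)
    have "segments_degenerate TYPE('a) ((c, 0) # rest) tsegs"
      using segments_degenerate_mset[OF rest[symmetric]] deg segments_degenerate_trans by blast
    then have "segments_degenerate TYPE('a) rest tsegs"
      by (simp add: segments_degenerate_def segment_drop_empty)
    moreover have "mset (map snd segs) = mset (map snd ((c, 0) # rest))"
      using rest by (metis mset_map)
    then have "mset (map snd rest) = M" using segs by simp
    ultimately show ?thesis using tsegs by blast
  qed
  have "\<exists>segs tsegs. mset (map snd segs) = M \<and> mset (map snd tsegs) = N \<and>
      segments_degenerate TYPE('a) segs tsegs"
    if "0 \<notin># N" "\<And>p. excess N p \<le> excess M p" "excess N 0 = excess M 0" for M N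
    using that
  proof (induction "size N" arbitrary: M N)
    case 0
    \<comment> \<open>Zero parts of \<open>M\<close> can survive to this point: the recursion
      creates one whenever \<open>a = L\<close> and \<open>b = 0\<close>.\<close>
    then have "\<forall>k\<in>#M. k = 0" using excess_mono[of _ M 0] by fastforce
    then have "\<exists>segs tsegs. mset (map snd segs) = M \<and> mset (map snd tsegs) = {#} \<and>
        segments_degenerate TYPE('a) segs tsegs"
    proof (induction M)
      case empty
      show ?case by (intro exI[of _ "[]"]) (simp add: segments_degenerate_refl)
    next
      case (add x M)
      then obtain segs where "mset (map snd segs) = M" "segments_degenerate TYPE('a) segs []"
        by auto
      then show ?case using add.prems
        by (intro exI[of _ "(0, 0) # segs"] exI[of _ "[]"])
          (simp add: segments_degenerate_def segment_drop_empty)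
    qed
    then show ?case using 0 by simp
  next
    case (Suc k)
    define L where "L = Max_mset N"
    have "N \<noteq> {#}" using Suc.hyps(2) by auto
    then have "L \<in># N" by (simp add: L_def)
    then obtain N' where N: "N = add_mset L N'" by (metis multi_member_split)
    have "x \<le> L" if "x \<in># N" for x
      using that by (simp add: L_def)
    then have le_L: "x \<le> L" if "x \<in># N'" for x
      using that by (simp add: N)
    have L: "0 < L" using Suc.prems(1) by (cases L) (auto simp: N)
    \<comment> \<open>At \<open>L - 1\<close> the part \<open>L\<close> contributes 1, so dominance
      forces a part of \<open>M\<close> that is at least \<open>L\<close>.\<close>
    have "excess M (L - 1) \<noteq> 0"
      using Suc.prems(2)[of "L - 1"] L by (simp add: N)
    then have ex: "\<exists>x. x \<in># M \<and> L \<le> x"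
      using excess_eq_0[of M "L - 1"] L by (metis Suc_diff_1 not_less_eq_eq)
    define a where "a = (LEAST x. x \<in># M \<and> L \<le> x)"
    have aM: "a \<in># M" and a: "L \<le> a" and a_least: "\<And>x. x \<in># M \<Longrightarrow> L \<le> x \<Longrightarrow> a \<le> x"
      using LeastI_ex[OF ex] Least_le[of "\<lambda>x. x \<in># M \<and> L \<le> x"] by (auto simp: a_def)
    obtain M1 where M1: "M = add_mset a M1" using aM by (metis multi_member_split)
    \<comment> \<open>Stated for any \<open>b\<close> below the gap, to cover both a genuine part of
      \<open>M\<close> and the padding by 0.\<close>
    have main: "\<exists>segs tsegs. mset (map snd segs) = add_mset a (add_mset b M') \<and>
        mset (map snd tsegs) = N \<and> segments_degenerate TYPE('a) segs tsegs"
      if b: "b < L" and gap: "\<And>x. x \<in># M' \<Longrightarrow> x \<le> b \<or> a \<le> x"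
        and dom: "\<And>p. excess N p \<le> excess (add_mset a (add_mset b M')) p"
        and eq: "excess N 0 = excess (add_mset a (add_mset b M')) 0" for b M'
      unfolding N
    proof (rule exists_segments_step[OF Suc.hyps(1) b a])
      show "k = size N'" using Suc.hyps(2) by (simp add: N)
      show "0 \<notin># N'" using Suc.prems(1) by (simp add: N)
      show "excess N' p \<le> excess (add_mset (a + b - L) M') p" for p
        by (rule excess_exchange[OF gap le_L b a]) (use dom in \<open>auto simp: N\<close>)
      show "excess N' 0 = excess (add_mset (a + b - L) M') 0"
        using eq a by (simp add: N)
    qed
    show ?case
    proof (cases "\<exists>x\<in>#M1. x < L")
      case True
      define F where "F = filter_mset (\<lambda>x. x < L) M1"
      have "F \<noteq> {#}" using True by (auto simp: F_def filter_mset_eq_conv)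
      define b where "b = Max_mset F"
      have bF: "b \<in># F" using \<open>F \<noteq> {#}\<close> by (simp add: b_def)
      then obtain M' where M': "M1 = add_mset b M'" by (metis F_def filter_mset_eq_conv multi_member_split mset_subset_eqD multiset_filter_subset)
      have "x \<le> b \<or> a \<le> x" if "x \<in># M'" for x
      proof (cases "x < L")
        case True
        then have "x \<in># F" using that by (simp add: F_def M')
        then show ?thesis by (simp add: b_def)
      next
        case False
        then show ?thesis using a_least[of x] that by (simp add: M1 M')
      qed
      moreover have "b < L" using bF by (simp add: F_def)
      ultimately show ?thesis
        using main[of b M'] Suc.prems by (simp add: M1 M')
    next
      case False
      have "x \<le> 0 \<or> a \<le> x" if "x \<in># M1" for x
        using that False a_least[of x] by (auto simp: M1 not_less)
      then have "\<exists>segs tsegs. mset (map snd segs) = add_mset a (add_mset 0 M1) \<and>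
          mset (map snd tsegs) = N \<and> segments_degenerate TYPE('a) segs tsegs"
        using main[of 0 M1] L Suc.prems by (simp add: M1)
      then show ?thesis using drop[of M N] by (simp add: M1 add_mset_commute)
    qed
  qed
  from this[OF assms] show ?thesis .
qed

section \<open>Ranks and Jordan forms of nilpotent matrices\<close>

text \<open>This encodes rank \<open>d\<close>: the one-sided inverses say that \<open>U\<close> is
  injective and \<open>V\<close> surjective. They are inherited by direct sums, and
  \<open>A * M * B = 1\<close> supplies the nonzero determinant for semicontinuity.\<close>

definition rank_factorization :: "nat \<Rightarrow> nat \<Rightarrow> 'a::field mat \<Rightarrow> bool" where
  "rank_factorization n d M \<longleftrightarrow>
     (\<exists>U\<in>carrier_mat n d. \<exists>V\<in>carrier_mat d n. \<exists>A\<in>carrier_mat d n. \<exists>B\<in>carrier_mat n d.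
        M = U * V \<and> A * U = 1\<^sub>m d \<and> V * B = 1\<^sub>m d)"

lemma rank_factorization_direct_sum:
  assumes "rank_factorization n d M" "rank_factorization n' d' M'"
  shows "rank_factorization (n + n') (d + d') (M \<boxplus> M')"
proof -
  obtain U V A B where 1: "U \<in> carrier_mat n d" "V \<in> carrier_mat d n" "A \<in> carrier_mat d n"
    "B \<in> carrier_mat n d" "M = U * V" "A * U = 1\<^sub>m d" "V * B = 1\<^sub>m d"
    using assms(1) unfolding rank_factorization_def by blast
  obtain U' V' A' B' where 2: "U' \<in> carrier_mat n' d'" "V' \<in> carrier_mat d' n'" "A' \<in> carrier_mat d' n'"
    "B' \<in> carrier_mat n' d'" "M' = U' * V'" "A' * U' = 1\<^sub>m d'" "V' * B' = 1\<^sub>m d'"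
    using assms(2) unfolding rank_factorization_def by blast
  show ?thesis
    unfolding rank_factorization_def
  proof (intro bexI conjI)
    show "M \<boxplus> M' = (U \<boxplus> U') * (V \<boxplus> V')"
      using 1 2 by (simp add: direct_sum_mat_mult[of U n d V n U' n' d' V' n'])
    show "(A \<boxplus> A') * (U \<boxplus> U') = 1\<^sub>m (d + d')"
      using 1 2 by (simp add: direct_sum_mat_mult[of A d n U d A' d' n' U' d'] direct_sum_mat_one)
    show "(V \<boxplus> V') * (B \<boxplus> B') = 1\<^sub>m (d + d')"
      using 1 2 by (simp add: direct_sum_mat_mult[of V d n B d V' d' n' B' d'] direct_sum_mat_one)
  qed (use 1 2 in auto)
qed

lemma segment_jordan_single_pow:
  "segment_jordan [(c, k)] ^\<^sub>m p = mat k k (\<lambda>(r, s). if r = s + p then 1 else 0 :: 'a::field_char_0)"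
proof (induction p)
  case 0
  then show ?case by (intro eq_matI) auto
next
  case (Suc p)
  let ?J = "segment_jordan [(c, k)] :: 'a mat"
  have J: "?J \<in> carrier_mat k k" by (intro carrier_matI) auto
  have "(?J ^\<^sub>m p * ?J) $$ (r, s) = (if r = s + Suc p then 1 else 0)" if rs: "r < k" "s < k" for r s
  proof -
    have "(?J ^\<^sub>m p * ?J) $$ (r, s) = (\<Sum>i<k. (?J ^\<^sub>m p) $$ (r, i) * ?J $$ (i, s))"
      using rs J by (intro index_mult_mat_sum[of _ k k _ k]) auto
    also have "\<dots> = (\<Sum>i<k. if i = Suc s then if r = Suc s + p then 1 else 0 else 0)"
      using rs by (intro sum.cong) (auto simp: Suc segment_single_index)
    also have "\<dots> = (if r = s + Suc p then 1 else 0)" using rs by auto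
    finally show ?thesis .
  qed
  then show ?case using J by (intro eq_matI) (auto simp del: segment_jordan_def)
qed

text \<open>The power forgets the last \<open>p\<close> coordinates, which is \<open>?V\<close>, and
  shifts the others by \<open>p\<close>, which is \<open>?U\<close>. For \<open>p \<ge> k\<close>
  the truncated difference makes both factors empty, as befits the zero matrix.\<close>

lemma rank_factorization_segment_single:
  "rank_factorization k (k - p) (segment_jordan [(c, k)] ^\<^sub>m p :: 'a::field_char_0 mat)"
proof -
  let ?U = "mat k (k - p) (\<lambda>(r, s). if r = s + p then 1 else 0) :: 'a mat"
  let ?V = "mat (k - p) k (\<lambda>(r, s). if r = s then 1 else 0) :: 'a mat"
  let ?A = "mat (k - p) k (\<lambda>(s, r). if r = s + p then 1 else 0) :: 'a mat"
  let ?B = "mat k (k - p) (\<lambda>(s, r). if r = s then 1 else 0) :: 'a mat"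
  have car: "?U \<in> carrier_mat k (k - p)" "?V \<in> carrier_mat (k - p) k"
    "?A \<in> carrier_mat (k - p) k" "?B \<in> carrier_mat k (k - p)" by auto
  have 1: "segment_jordan [(c, k)] ^\<^sub>m p = ?U * ?V"
  proof (rule eq_matI)
    fix r s assume "r < dim_row (?U * ?V)" "s < dim_col (?U * ?V)"
    then have rs: "r < k" "s < k" by auto
    have "(?U * ?V) $$ (r, s) = (\<Sum>i<k - p. if i = s then if r = s + p then 1 else 0 else 0)"
      using rs unfolding index_mult_mat_sum[OF car(1,2) rs] by (intro sum.cong) auto
    then show "(segment_jordan [(c, k)] ^\<^sub>m p) $$ (r, s) = (?U * ?V) $$ (r, s)"
      using rs by (auto simp: segment_jordan_single_pow)
  qed (auto simp: segment_jordan_single_pow)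
  have 2: "?A * ?U = 1\<^sub>m (k - p)"
  proof (rule eq_matI)
    fix r s assume "r < dim_row (1\<^sub>m (k - p))" "s < dim_col (1\<^sub>m (k - p))"
    then have rs: "r < k - p" "s < k - p" by auto
    have "(?A * ?U) $$ (r, s) = (\<Sum>i<k. if i = r + p then if r = s then 1 else 0 else 0)"
      using rs unfolding index_mult_mat_sum[OF car(3,1) rs] by (intro sum.cong) auto
    then show "(?A * ?U) $$ (r, s) = 1\<^sub>m (k - p) $$ (r, s)"
      using rs by auto
  qed auto
  have 3: "?V * ?B = 1\<^sub>m (k - p)"
  proof (rule eq_matI)
    fix r s assume "r < dim_row (1\<^sub>m (k - p))" "s < dim_col (1\<^sub>m (k - p))"
    then have rs: "r < k - p" "s < k - p" by auto
    have "(?V * ?B) $$ (r, s) = (\<Sum>i<k. if i = r then if r = s then 1 else 0 else 0)"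
      using rs unfolding index_mult_mat_sum[OF car(2,4) rs] by (intro sum.cong) auto
    then show "(?V * ?B) $$ (r, s) = 1\<^sub>m (k - p) $$ (r, s)"
      using rs by auto
  qed auto
  show ?thesis
    unfolding rank_factorization_def using car 1 2 3 by blast
qed

lemma rank_factorization_segment_jordan:
  "rank_factorization (segment_size s) (excess (mset (map snd s)) p)
     (segment_jordan s ^\<^sub>m p :: 'a::field_char_0 mat)"
proof (induction s)
  case Nil
  have "segment_jordan [] ^\<^sub>m p = (1\<^sub>m 0 :: 'a mat)" by (intro eq_matI) auto
  then show ?case
    unfolding rank_factorization_def by (intro bexI[of _ "1\<^sub>m 0"]) auto
next
  case (Cons x s)
  have "segment_jordan (x # s) ^\<^sub>m p = (segment_jordan [x] ^\<^sub>m p \<boxplus> segment_jordan s ^\<^sub>m p :: 'a mat)"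
    unfolding segment_Cons(2)[of x s] by (rule direct_sum_mat_pow) (rule segment_carrier)+
  then show ?case
    using rank_factorization_direct_sum[OF rank_factorization_segment_single[of "snd x" p "fst x"] Cons.IH]
    by simp
qed

text \<open>Padding \<open>C\<close> by zero columns and \<open>D\<close> by zero rows to square
  matrices does not change the product, and the padded \<open>D\<close> has a zero row.\<close>

lemma det_mult_thin:
  fixes C :: "'a::field mat"
  assumes C: "C \<in> carrier_mat d e" and D: "D \<in> carrier_mat e d" and "e < d"
  shows "det (C * D) = 0"
proof -
  define C' where "C' = mat d d (\<lambda>(i, j). if j < e then C $$ (i, j) else 0)"
  define D' where "D' = mat d d (\<lambda>(i, j). if i < e then D $$ (i, j) else 0)"
  have car: "C' \<in> carrier_mat d d" "D' \<in> carrier_mat d d" by (auto simp: C'_def D'_def)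
  have "C * D = C' * D'"
  proof (rule eq_matI)
    fix i j assume "i < dim_row (C' * D')" "j < dim_col (C' * D')"
    then have ij: "i < d" "j < d" using car by auto
    have "(C' * D') $$ (i, j) = (\<Sum>k<d. if k < e then C $$ (i, k) * D $$ (k, j) else 0)"
      unfolding index_mult_mat_sum[OF car ij] using ij by (intro sum.cong) (auto simp: C'_def D'_def)
    also have "\<dots> = (\<Sum>k<e. C $$ (i, k) * D $$ (k, j))"
      using \<open>e < d\<close> by (intro sum.mono_neutral_cong_right) auto
    finally show "(C * D) $$ (i, j) = (C' * D') $$ (i, j)"
      by (simp add: index_mult_mat_sum[OF C D ij])
  qed (use C D car in auto)
  moreover have "det D' = 0"
  proof -
    have "D' = mat\<^sub>r d d (\<lambda>i. if i = e then 0\<^sub>v d else row D' i)"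
      by (rule eq_matI) (auto simp: D'_def)
    moreover have "det (mat\<^sub>r d d (\<lambda>i. if i = e then 0\<^sub>v d else row D' i)) = 0"
      by (rule det_row_0) (use \<open>e < d\<close> car in auto)
    ultimately show ?thesis by simp
  qed
  ultimately show ?thesis using det_mult[OF car] by simp
qed

section \<open>Jordan form of a nilpotent matrix over an arbitrary field\<close>

lemma similar_mat_transpose:
  fixes A B :: "'a::comm_ring_1 mat"
  assumes "similar_mat A B"
  shows "similar_mat (transpose_mat A) (transpose_mat B)"
proof -
  obtain n P Q where car: "{A, B, P, Q} \<subseteq> carrier_mat n n" and PQ: "P * Q = 1\<^sub>m n" "Q * P = 1\<^sub>m n"
    and A: "A = P * B * Q" using similar_matD[OF assms] by blast
  have "transpose_mat A = transpose_mat Q * (transpose_mat B * transpose_mat P)"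
    unfolding A using car transpose_mult[of "P * B" n n Q n] transpose_mult[of P n n B n] by auto
  then have "transpose_mat A = transpose_mat Q * transpose_mat B * transpose_mat P"
    using car by (simp add: assoc_mult_mat[of _ n n _ n _ n])
  moreover have "transpose_mat Q * transpose_mat P = 1\<^sub>m n"
    using car PQ(1) transpose_mult[of P n n Q n] by simp
  moreover have "transpose_mat P * transpose_mat Q = 1\<^sub>m n"
    using car PQ(2) transpose_mult[of Q n n P n] by simp
  ultimately show ?thesis using car
    by (intro similar_matI[of _ _ "transpose_mat Q" "transpose_mat P" n]) auto
qed

lemma transpose_direct_sum: "transpose_mat (A \<boxplus> B) = transpose_mat A \<boxplus> transpose_mat B"
  by (rule eq_matI) (auto simp: direct_sum_mat_index)

lemma transpose_diag_block_mat:
  "transpose_mat (diag_block_mat As) = diag_block_mat (map transpose_mat As)"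
  by (induction As) (simp_all add: diag_block_mat_Cons transpose_direct_sum del: diag_block_mat.simps(2))

lemma mat_pow_commute: "A \<in> carrier_mat n n \<Longrightarrow> A * A ^\<^sub>m k = A ^\<^sub>m k * (A :: 'a::semiring_1 mat)"
proof (induction k)
  case (Suc k)
  have "A * (A ^\<^sub>m k * A) = (A * A ^\<^sub>m k) * A"
    using Suc.prems by (simp add: assoc_mult_mat[of A n n _ n _ n])
  then show ?case using Suc by simp
qed simp

lemma transpose_pow:
  fixes A :: "'a::comm_semiring_1 mat"
  assumes "A \<in> carrier_mat n n"
  shows "transpose_mat (A ^\<^sub>m k) = transpose_mat A ^\<^sub>m k"
proof (induction k)
  case (Suc k)
  then show ?case
    using assms mat_pow_commute[of "transpose_mat A" n k]
    by (simp add: transpose_mult[of _ n n _ n])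
qed (use assms in auto)

lemma similar_pow_eq_0:
  fixes A B :: "'a::comm_ring_1 mat"
  assumes sim: "similar_mat A B" and A: "A \<in> carrier_mat n n" and k: "A ^\<^sub>m k = 0\<^sub>m n n"
  shows "B ^\<^sub>m k = 0\<^sub>m n n" "B \<in> carrier_mat n n"
proof -
  obtain P Q where wit: "similar_mat_wit B A P Q"
    using similar_mat_sym[OF sim] unfolding similar_mat_def by blast
  have B: "B \<in> carrier_mat n n"
    using similar_matD[OF sim] A by (auto dest: carrier_matD)
  then show "B \<in> carrier_mat n n" .
  note w = similar_mat_witD2[OF B wit]
  show "B ^\<^sub>m k = 0\<^sub>m n n"
    unfolding similar_mat_wit_pow_id[OF wit] k using w by simp
qed

lemma det_pow: "A \<in> carrier_mat n n \<Longrightarrow> det (A ^\<^sub>m k) = det (A :: 'a::comm_ring_1 mat) ^ k"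
  by (induction k) (simp_all add: det_mult[of _ n] carrier_matD)

lemma exists_invertible_first_col:
  fixes v :: "'a::field vec"
  assumes v: "v \<in> carrier_vec n" and v0: "v \<noteq> 0\<^sub>v n" and n: "0 < n"
  shows "\<exists>P Q. mat_conjugator n P Q \<and> col P 0 = v"
proof -
  interpret vec_space "TYPE('a)" n .
  let ?bs = "basis_completion v"
  define P where "P = mat_of_cols n ?bs"
  note bc = basis_completion[OF v v0]
  have P: "P \<in> carrier_mat n n" unfolding P_def using bc(6) by (metis mat_of_cols_carrier(1))
  have cols: "cols P = ?bs" unfolding P_def using bc(2) by simp
  have "rank P = n" using lin_indpt_full_rank[OF P] bc cols by simp
  then have "det P \<noteq> 0" using det_rank_iff[OF P] by simp
  then obtain Q where Q: "Q \<in> carrier_mat n n" "P * Q = 1\<^sub>m n" "Q * P = 1\<^sub>m n"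
    using det_non_zero_imp_unit[OF P, of "()"] by (auto simp: Units_def ring_mat_simps)
  have "?bs \<noteq> []" using bc(6) n by auto
  then have "col P 0 = v" using bc(7) cols P n
    by (metis carrier_matD(2) cols_nth hd_conv_nth)
  then show ?thesis using P Q by (auto simp: mat_conjugator_def)
qed

text \<open>No root of a polynomial has to be found in the field: a nilpotent matrix is singular, so
  a kernel vector can be the first basis vector, and the remaining diagonal block is again
  nilpotent.\<close>

lemma nilpotent_similar_upper_triangular:
  fixes X :: "'a::field mat"
  assumes "X \<in> carrier_mat n n" "X ^\<^sub>m k = 0\<^sub>m n n"
  shows "\<exists>T. similar_mat X T \<and> upper_triangular T"
  using assms
proof (induction n arbitrary: X)
  case 0
  then show ?case using similar_mat_refl[of X 0] by (intro exI[of _ X]) (auto simp: upper_triangular_def)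
next
  case (Suc n)
  have "det X ^ k = 0" using det_pow[OF Suc.prems(1), of k] Suc.prems(2) by simp
  then have "det X = 0" by simp
  then obtain v where v: "v \<in> carrier_vec (Suc n)" "v \<noteq> 0\<^sub>v (Suc n)" "X *\<^sub>v v = 0\<^sub>v (Suc n)"
    using det_0_iff_vec_prod_zero[OF Suc.prems(1)] by blast
  obtain P Q where PQ: "mat_conjugator (Suc n) P Q" "col P 0 = v"
    using exists_invertible_first_col[OF v(1,2)] by auto
  then have car: "P \<in> carrier_mat (Suc n) (Suc n)" "Q \<in> carrier_mat (Suc n) (Suc n)"
    "P * Q = 1\<^sub>m (Suc n)" "Q * P = 1\<^sub>m (Suc n)" by (auto simp: mat_conjugator_def)
  define Y where "Y = Q * X * P"
  have Y: "Y \<in> carrier_mat (Suc n) (Suc n)" using car Suc.prems by (auto simp: Y_def)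
  have "similar_mat Y X"
    unfolding Y_def by (rule similar_matI[of _ _ Q P "Suc n"]) (use car Suc.prems in auto)
  then have sim: "similar_mat X Y" by (rule similar_mat_sym)
  note Yk = similar_pow_eq_0(1)[OF sim Suc.prems]
  have "col Y 0 = (Q * X) *\<^sub>v col P 0"
    unfolding Y_def using car Suc.prems by (intro col_mult2[of _ "Suc n" "Suc n"]) auto
  also have "\<dots> = Q *\<^sub>v (X *\<^sub>v v)"
    using car Suc.prems v by (simp add: PQ assoc_mult_mat_vec[of _ "Suc n" "Suc n" _ "Suc n"])
  also have "\<dots> = 0\<^sub>v (Suc n)" using car v by auto
  finally have col0: "Y $$ (i, 0) = 0" if "i < Suc n" for i
    using that Y by (metis carrier_matD(1) carrier_matD(2) index_col index_zero_vec(1) zero_less_Suc)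
  obtain A B C D where split: "split_block Y 1 1 = (A, B, C, D)" by (metis prod_cases4)
  note sb = split_block[OF split, of n n]
  have dims: "dim_row Y = 1 + n" "dim_col Y = 1 + n" using Y by auto
  have blocks: "A \<in> carrier_mat 1 1" "B \<in> carrier_mat 1 n" "C \<in> carrier_mat n 1" "D \<in> carrier_mat n n"
    "Y = four_block_mat A B C D" using sb[OF dims] by auto
  have C0: "C = 0\<^sub>m n 1"
  proof (rule eq_matI)
    fix i j assume "i < dim_row (0\<^sub>m n 1 :: 'a mat)" "j < dim_col (0\<^sub>m n 1 :: 'a mat)"
    then have ij: "i < n" "j = 0" by auto
    then have "C $$ (i, j) = Y $$ (Suc i, 0)" using blocks by simp
    then show "C $$ (i, j) = 0\<^sub>m n 1 $$ (i, j)" using ij col0[of "Suc i"] by simp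
  qed (use blocks in auto)
  \<comment> \<open>Powers of a block triangular matrix have the powers of \<open>D\<close> in the
    corner, whatever the other blocks become.\<close>
  have "\<exists>A' B'. A' \<in> carrier_mat 1 1 \<and> B' \<in> carrier_mat 1 n \<and>
      Y ^\<^sub>m j = four_block_mat A' B' (0\<^sub>m n 1) (D ^\<^sub>m j)" for j
  proof (induction j)
    case 0
    have "Y ^\<^sub>m 0 = four_block_mat (1\<^sub>m 1) (0\<^sub>m 1 n) (0\<^sub>m n 1) (1\<^sub>m n)"
      using Y by (intro eq_matI) auto
    then show ?case using blocks(4)
      by (intro exI[of _ "1\<^sub>m 1"] exI[of _ "0\<^sub>m 1 n"]) auto
  next
    case (Suc j)
    then obtain A' B' where IH: "A' \<in> carrier_mat 1 1" "B' \<in> carrier_mat 1 n"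
      "Y ^\<^sub>m j = four_block_mat A' B' (0\<^sub>m n 1) (D ^\<^sub>m j)" by blast
    have "Y ^\<^sub>m Suc j = four_block_mat (A' * A) (A' * B + B' * D) (0\<^sub>m n 1) (D ^\<^sub>m Suc j)"
      unfolding pow_mat.simps IH(3) unfolding blocks(5) C0
      by (subst mult_four_block_mat[of _ 1 1 _ n _ n _ _ 1 _ n]) (use blocks IH in auto)
    moreover have "A' * A \<in> carrier_mat 1 1" "A' * B + B' * D \<in> carrier_mat 1 n"
      using blocks(1-4) IH(1,2) by auto
    ultimately show ?case by blast
  qed
  then obtain A' B' where AB': "A' \<in> carrier_mat 1 1" "B' \<in> carrier_mat 1 n"
    "Y ^\<^sub>m k = four_block_mat A' B' (0\<^sub>m n 1) (D ^\<^sub>m k)" by blast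
  have "D ^\<^sub>m k = 0\<^sub>m n n"
  proof (rule eq_matI)
    have Dk: "D ^\<^sub>m k \<in> carrier_mat n n" using blocks by auto
    fix i j assume "i < dim_row (0\<^sub>m n n :: 'a mat)" "j < dim_col (0\<^sub>m n n :: 'a mat)"
    then have ij: "i < n" "j < n" by auto
    then have "(D ^\<^sub>m k) $$ (i, j) = (Y ^\<^sub>m k) $$ (Suc i, Suc j)"
      unfolding AB'(3) using carrier_matD[OF AB'(1)] carrier_matD[OF blocks(4)] by simp
    then show "(D ^\<^sub>m k) $$ (i, j) = 0\<^sub>m n n $$ (i, j)" using ij Yk by simp
  qed (use blocks in auto)
  then obtain T where T: "similar_mat D T" "upper_triangular T"
    using Suc.IH[of D] blocks by blast
  have Tc: "T \<in> carrier_mat n n" using similar_matD[OF T(1)] blocks by (auto dest: carrier_matD)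
  obtain B0 where B0: "B0 \<in> carrier_mat 1 n"
    "similar_mat (four_block_mat A B (0\<^sub>m n 1) D) (four_block_mat A B0 (0\<^sub>m n 1) T)"
    using similar_mat_four_block_0_ex[OF similar_mat_refl[OF blocks(1)] T(1) blocks(2,1,4)] by blast
  have "upper_triangular (four_block_mat A B0 (0\<^sub>m n 1) T)"
    using upper_triangular_four_block[of A 1 T n B0] blocks Tc T by (auto simp: upper_triangular_def)
  moreover have "similar_mat X (four_block_mat A B0 (0\<^sub>m n 1) T)"
    using sim B0(2) similar_mat_trans unfolding blocks(5) C0 by blast
  ultimately show ?case by blast
qed

lemma direct_sum_eq_0:
  assumes "A \<boxplus> B = 0\<^sub>m m n"
  shows "A = 0\<^sub>m (dim_row A) (dim_col A)" "B = 0\<^sub>m (dim_row B) (dim_col B)"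
proof -
  have d: "m = dim_row A + dim_row B" "n = dim_col A + dim_col B"
    using arg_cong[OF assms, of dim_row] arg_cong[OF assms, of dim_col] by auto
  show "A = 0\<^sub>m (dim_row A) (dim_col A)"
  proof (rule eq_matI)
    fix i j assume "i < dim_row (0\<^sub>m (dim_row A) (dim_col A))" "j < dim_col (0\<^sub>m (dim_row A) (dim_col A))"
    then show "A $$ (i, j) = 0\<^sub>m (dim_row A) (dim_col A) $$ (i, j)"
      using arg_cong[OF assms, of "\<lambda>M. M $$ (i, j)"] by (simp add: d direct_sum_mat_index)
  qed auto
  show "B = 0\<^sub>m (dim_row B) (dim_col B)"
  proof (rule eq_matI)
    fix i j assume "i < dim_row (0\<^sub>m (dim_row B) (dim_col B))" "j < dim_col (0\<^sub>m (dim_row B) (dim_col B))"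
    then show "B $$ (i, j) = 0\<^sub>m (dim_row B) (dim_col B) $$ (i, j)"
      using arg_cong[OF assms, of "\<lambda>M. M $$ (dim_row A + i, dim_col A + j)"]
      by (simp add: d direct_sum_mat_index)
  qed auto
qed

lemma diag_block_mat_eq_0:
  "diag_block_mat As = 0\<^sub>m m n \<Longrightarrow> A \<in> set As \<Longrightarrow> A = 0\<^sub>m (dim_row A) (dim_col A)"
proof (induction As arbitrary: m n)
  case (Cons B As)
  have "B \<boxplus> diag_block_mat As = 0\<^sub>m m n" using Cons.prems(1) by (simp only: diag_block_mat_Cons)
  note 0 = direct_sum_eq_0[OF this]
  show ?case using Cons.prems(2) 0 Cons.IH[OF 0(2)] by auto
qed simp

text \<open>The passage from triangular to Jordan form yields upper triangular blocks, so it is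
  applied to the transpose of \<open>X\<close> and transposed back.\<close>

lemma nilpotent_similar_segment_jordan:
  fixes X :: "'a::field_char_0 mat"
  assumes "nilpotent_mat n X"
  shows "\<exists>s. 0 \<notin> set (map snd s) \<and> segment_size s = n \<and> similar_mat X (segment_jordan s)"
proof -
  obtain k where X: "X \<in> carrier_mat n n" and k: "X ^\<^sub>m k = 0\<^sub>m n n"
    using assms by (auto simp: nilpotent_mat_def)
  have Xt: "transpose_mat X \<in> carrier_mat n n" "transpose_mat X ^\<^sub>m k = 0\<^sub>m n n"
    using X k transpose_pow[OF X, of k] by auto
  obtain T where T: "similar_mat (transpose_mat X) T" "upper_triangular T"
    using nilpotent_similar_upper_triangular[OF Xt] by blast
  have "T \<in> carrier_mat n n" using similar_pow_eq_0(2)[OF T(1) Xt] .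
  then obtain l where "jordan_nf T l" using triangular_to_jnf_vector[OF _ T(2)] by blast
  then have l: "0 \<notin> fst ` set l" "similar_mat (transpose_mat X) (jordan_matrix l)"
    using T similar_mat_trans unfolding jordan_nf_def by blast+
  note J = similar_pow_eq_0[OF l(2) Xt]
  \<comment> \<open>The entry \<open>(0, 0)\<close> of the \<open>k\<close>-th power of the block is
    \<open>a ^ k\<close>.\<close>
  have zero: "a = 0" if "(m, a) \<in> set l" for m a
  proof -
    have "jordan_block m a ^\<^sub>m k = 0\<^sub>m m m"
      using diag_block_mat_eq_0[OF J(1)[unfolded jordan_matrix_pow], of "jordan_block m a ^\<^sub>m k"] that
      by force
    moreover have "0 < m" using l(1) that by force
    ultimately have "(jordan_block m a ^\<^sub>m k) $$ (0, 0) = 0" by simp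
    then show ?thesis using \<open>0 < m\<close> by (simp add: jordan_block_pow)
  qed
  \<comment> \<open>The starts do not enter \<open>segment_jordan\<close>; 0 is a
    placeholder.\<close>
  define s where "s = map (\<lambda>(m, a :: 'a). (0 :: int, m)) l"
  have "map transpose_mat (map (\<lambda>(m, a). jordan_block m a) l) =
        map (\<lambda>(c, m). transpose_mat (jordan_block m 0)) s"
    unfolding s_def using zero by (auto simp: split_beta)
  then have "transpose_mat (jordan_matrix l) = segment_jordan s"
    unfolding jordan_matrix_def transpose_diag_block_mat segment_jordan_def
    by (rule arg_cong)
  then have "similar_mat X (segment_jordan s)"
    using similar_mat_transpose[OF l(2)] by simp
  moreover have "0 \<notin> set (map snd s)" using l(1) by (auto simp: s_def split_beta)
  moreover have "segment_size s = n"
  proof -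
    have "dim_row (jordan_matrix l) = n" using carrier_matD(1)[OF J(2)] .
    then show ?thesis by (simp add: segment_size_def s_def o_def split_beta jordan_matrix_dim)
  qed
  ultimately show ?thesis by blast
qed

section \<open>Orbits and their closures\<close>

lemma GL_inverse:
  assumes "mat_conjugator n g h"
  shows "g \<in> carrier (GL n)" "inv\<^bsub>GL n\<^esub> g = h"
proof -
  interpret R: ring "ring_mat TYPE('a) n ()" by (rule ring_mat)
  have g: "g \<in> carrier (GL n)" and h: "h \<in> carrier (GL n)"
    using assms by (auto simp: GL_def units_of_def Units_def ring_mat_simps mat_conjugator_def)
  show "g \<in> carrier (GL n)" by (fact g)
  have "group (GL n :: 'a mat monoid)" unfolding GL_def by (rule R.units_group)
  moreover have "h \<otimes>\<^bsub>GL n\<^esub> g = \<one>\<^bsub>GL n\<^esub>"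
    using assms by (simp add: GL_def units_of_def ring_mat_simps mat_conjugator_def)
  ultimately show "inv\<^bsub>GL n\<^esub> g = h" using group.inv_equality g h by metis
qed

lemma carrier_GL: "carrier (GL n) = {g. \<exists>h. mat_conjugator n g h}"
  using GL_inverse(1)
  by (auto simp: GL_def units_of_def Units_def ring_mat_simps mat_conjugator_def)

lemma mat_trace_mult_commute:
  fixes A :: "'a::comm_semiring_0 mat"
  assumes "A \<in> carrier_mat n m" "B \<in> carrier_mat m n"
  shows "mat_trace (A * B) = mat_trace (B * A)"
proof -
  have "mat_trace (A * B) = (\<Sum>i<n. \<Sum>k<m. A $$ (i, k) * B $$ (k, i))"
    using assms by (simp add: mat_trace_def scalar_prod_def atLeast0LessThan)
  also have "\<dots> = (\<Sum>k<m. \<Sum>i<n. B $$ (k, i) * A $$ (i, k))"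
    by (subst sum.swap) (simp add: mult.commute)
  also have "\<dots> = mat_trace (B * A)"
    using assms by (simp add: mat_trace_def scalar_prod_def atLeast0LessThan)
  finally show ?thesis .
qed

lemma mat_trace_add:
  "A \<in> carrier_mat n n \<Longrightarrow> B \<in> carrier_mat n n \<Longrightarrow> mat_trace (A + B) = mat_trace A + mat_trace B"
  by (simp add: mat_trace_def sum.distrib)

lemma mat_trace_smult:
  "A \<in> carrier_mat n n \<Longrightarrow> mat_trace (c \<cdot>\<^sub>m A) = c * mat_trace (A :: 'a::semiring_0 mat)"
  by (simp add: mat_trace_def sum_distrib_left)

lemma trace_form_in_gl_dual: "X \<in> carrier_mat n n \<Longrightarrow> trace_form n X \<in> gl_dual n"
  by (auto simp: gl_dual_def trace_form_def mult_add_distrib_mat[of _ n n _ n] mat_trace_add[of _ n]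
      mult_smult_distrib[of _ n n _ n] mat_trace_smult[of _ n])

lemma trace_form_add_smult:
  assumes "X \<in> carrier_mat n n" "E \<in> carrier_mat n n" "Y \<in> carrier_mat n n"
  shows "trace_form n (X + t \<cdot>\<^sub>m E) Y = trace_form n X Y + t * trace_form n E Y"
  using assms
  by (simp add: trace_form_def add_mult_distrib_mat[of _ n n _ _ n] mat_trace_add[of _ n]
      mult_smult_assoc_mat[of _ n n _ n] mat_trace_smult[of _ n])

text \<open>Cyclicity of the trace turns the coadjoint action into conjugation of the representing
  matrix.\<close>

lemma coadjoint_trace_form:
  assumes gh: "mat_conjugator n g h" and X: "X \<in> carrier_mat n n"
  shows "coadjoint n g (trace_form n X) = trace_form n (g * X * h)"
proof
  fix Y
  have car: "g \<in> carrier_mat n n" "h \<in> carrier_mat n n" using gh by (auto simp: mat_conjugator_def)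
  show "coadjoint n g (trace_form n X) Y = trace_form n (g * X * h) Y"
  proof (cases "Y \<in> carrier_mat n n")
    case True
    have "mat_trace (X * (h * Y * g)) = mat_trace ((X * h * Y) * g)"
      using True X car by (simp add: assoc_mult_mat[of _ n n _ n _ n])
    also have "\<dots> = mat_trace (g * (X * h * Y))"
      using True X car by (intro mat_trace_mult_commute[of _ n n]) auto
    also have "\<dots> = mat_trace (g * X * h * Y)"
      using True X car by (simp add: assoc_mult_mat[of _ n n _ n _ n])
    finally show ?thesis using True X car
      by (simp add: coadjoint_def GL_inverse[OF gh] trace_form_def)
  qed (simp add: coadjoint_def trace_form_def)
qed

lemma orbit_GL:
  assumes "X \<in> carrier_mat n n"
  shows "orbit (GL n) (coadjoint n) (trace_form n X) =
         {trace_form n (g * X * h) | g h. mat_conjugator n g h}"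
  unfolding orbit_def carrier_GL
  by (auto simp: coadjoint_trace_form[OF _ assms];
      blast intro: coadjoint_trace_form[OF _ assms, symmetric])

lemma orbit_GL_centralizer:
  assumes "X \<in> carrier_mat n n"
  shows "orbit (GL_centralizer n S) (coadjoint n) (trace_form n X) =
         {trace_form n (g * X * h) | g h. mat_conjugator n g h \<and> g * S = S * g}"
  unfolding orbit_def GL_centralizer_def
  by (auto simp: coadjoint_trace_form[OF _ assms] carrier_GL;
      blast intro: coadjoint_trace_form[OF _ assms, symmetric])

section \<open>Topology of the dual and closures of centralizer orbits\<close>

lemma topspace_gl_dual_topology [simp]: "topspace (gl_dual_topology n) = gl_dual n"
  by (auto simp: gl_dual_topology_def gl_dual_def PiE_def)

lemma continuous_map_gl_dual_eval:
  "Y \<in> carrier_mat n n \<Longrightarrow> continuous_map (gl_dual_topology n) euclidean (\<lambda>\<phi>. \<phi> Y)"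
  unfolding gl_dual_topology_def
  by (intro continuous_map_from_subtopology continuous_map_product_projection)

lemma continuous_map_into_gl_dual:
  "continuous_map T (gl_dual_topology n) f \<longleftrightarrow>
     f \<in> topspace T \<rightarrow> gl_dual n \<and>
     (\<forall>Y\<in>carrier_mat n n. continuous_map T euclidean (\<lambda>x. f x Y))"
  unfolding gl_dual_topology_def continuous_map_in_subtopology continuous_map_componentwise
  by (auto simp: gl_dual_def)

lemma coadjoint_in_gl_dual:
  assumes gh: "mat_conjugator n g h" and \<phi>: "\<phi> \<in> gl_dual n"
  shows "coadjoint n g \<phi> \<in> gl_dual n"
proof -
  have car: "g \<in> carrier_mat n n" "h \<in> carrier_mat n n" using gh by (auto simp: mat_conjugator_def)
  have "h * (X + Y) * g = h * X * g + h * Y * g" if "X \<in> carrier_mat n n" "Y \<in> carrier_mat n n" for X Y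
    using that car by (simp add: mult_add_distrib_mat[of _ n n _ n] add_mult_distrib_mat[of _ n n _ _ n])
  moreover have "h * (c \<cdot>\<^sub>m X) * g = c \<cdot>\<^sub>m (h * X * g)" if "X \<in> carrier_mat n n" for c X
    using that car by (simp add: mult_smult_distrib[of _ n n _ n] mult_smult_assoc_mat[of _ n n _ n])
  ultimately show ?thesis
    using \<phi> car by (auto simp: gl_dual_def coadjoint_def GL_inverse[OF gh])
qed

lemma continuous_map_coadjoint:
  assumes gh: "mat_conjugator n g h"
  shows "continuous_map (gl_dual_topology n) (gl_dual_topology n) (coadjoint n g)"
proof -
  have car: "g \<in> carrier_mat n n" "h \<in> carrier_mat n n" using gh by (auto simp: mat_conjugator_def)
  have "continuous_map (gl_dual_topology n) euclidean (\<lambda>\<phi>. coadjoint n g \<phi> Y)"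
    if "Y \<in> carrier_mat n n" for Y
    using that car continuous_map_gl_dual_eval[of "h * Y * g" n]
    by (simp add: coadjoint_def GL_inverse[OF gh])
  then show ?thesis
    using coadjoint_in_gl_dual[OF gh] by (auto simp: continuous_map_into_gl_dual)
qed

lemma continuous_map_trace_form_line:
  fixes X E :: "'a::local_field_char_0 mat"
  assumes "X \<in> carrier_mat n n" "E \<in> carrier_mat n n"
  shows "continuous_map euclidean (gl_dual_topology n) (\<lambda>t. trace_form n (X + t \<cdot>\<^sub>m E))"
  using assms
  by (auto simp: continuous_map_into_gl_dual trace_form_add_smult trace_form_in_gl_dual
      intro!: continuous_on_add continuous_on_mult' continuous_on_id continuous_on_const)

lemma mat_conjugator_mult:
  assumes "mat_conjugator n P Q" "mat_conjugator n P' Q'"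
  shows "mat_conjugator n (P * P') (Q' * Q)"
proof -
  have car: "P \<in> carrier_mat n n" "Q \<in> carrier_mat n n" "P' \<in> carrier_mat n n" "Q' \<in> carrier_mat n n"
    using assms by (auto simp: mat_conjugator_def)
  have "P * P' * (Q' * Q) = P * (P' * Q') * Q" "Q' * Q * (P * P') = Q' * (Q * P) * P'"
    using car by (simp_all add: assoc_mult_mat[of _ n n _ n _ n])
  then show ?thesis using assms car by (auto simp: mat_conjugator_def)
qed

lemma mat_conjugator_sym: "mat_conjugator n P Q \<Longrightarrow> mat_conjugator n Q P"
  by (auto simp: mat_conjugator_def)

lemma mat_conjugator_cancel:
  assumes "mat_conjugator n P Q" "Z \<in> carrier_mat n n"
  shows "P * (Q * Z) = Z" "Q * (P * Z) = Z"
  using assms assoc_mult_mat[of P n n Q n Z n, symmetric] assoc_mult_mat[of Q n n P n Z n, symmetric]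
  by (auto simp: mat_conjugator_def)

lemma mat_conjugator_intertwine:
  assumes PQ: "mat_conjugator n P Q" and "S \<in> carrier_mat n n" "S' \<in> carrier_mat n n" "P * S = S' * P"
  shows "Q * S' = S * Q"
proof -
  have car: "P \<in> carrier_mat n n" "Q \<in> carrier_mat n n" and 1: "P * Q = 1\<^sub>m n"
    using PQ by (auto simp: mat_conjugator_def)
  have "Q * S' = Q * (S' * (P * Q))" unfolding 1 using assms(3) by simp
  also have "\<dots> = Q * ((P * S) * Q)"
    using assms car by (simp add: assoc_mult_mat[of _ n n _ n _ n])
  also have "\<dots> = S * Q"
    using assms(2,3) car by (simp add: assoc_mult_mat[of _ n n _ n _ n] mat_conjugator_cancel[OF PQ])
  finally show ?thesis .
qed

text \<open>The action of \<open>g\<close> is continuous and maps the orbit into itself, hence also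
  its closure. This is what allows successive degenerations to be chained.\<close>

lemma closure_orbit_centralizer_invariant:
  fixes S :: "'a::local_field_char_0 mat"
  assumes gh: "mat_conjugator n g h" and gS: "g * S = S * g" and S: "S \<in> carrier_mat n n"
    and X: "X \<in> carrier_mat n n"
    and \<phi>: "\<phi> \<in> gl_dual_topology n closure_of orbit (GL_centralizer n S) (coadjoint n) (trace_form n X)"
  shows "coadjoint n g \<phi> \<in>
    gl_dual_topology n closure_of orbit (GL_centralizer n S) (coadjoint n) (trace_form n X)"
proof -
  let ?O = "orbit (GL_centralizer n S) (coadjoint n) (trace_form n X)"
  have "coadjoint n g ` ?O \<subseteq> ?O"
  proof
    fix \<psi> assume "\<psi> \<in> coadjoint n g ` ?O"
    then obtain g' h' where g': "mat_conjugator n g' h'" "g' * S = S * g'"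
      and \<psi>: "\<psi> = coadjoint n g (trace_form n (g' * X * h'))"
      unfolding orbit_GL_centralizer[OF X] by blast
    have car: "g \<in> carrier_mat n n" "h \<in> carrier_mat n n" "g' \<in> carrier_mat n n" "h' \<in> carrier_mat n n"
      using gh g' by (auto simp: mat_conjugator_def)
    have "\<psi> = trace_form n (g * g' * X * (h' * h))"
      unfolding \<psi> using car X by (simp add: coadjoint_trace_form[OF gh] assoc_mult_mat[of _ n n _ n _ n])
    moreover have "g * g' * S = S * (g * g')"
    proof -
      have "g * g' * S = g * (g' * S)" using car S by (intro assoc_mult_mat)
      also have "\<dots> = (g * S) * g'" unfolding g'(2) using car S by (intro assoc_mult_mat[symmetric])
      also have "\<dots> = S * (g * g')" unfolding gS using car S by (intro assoc_mult_mat)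
      finally show ?thesis .
    qed
    ultimately show "\<psi> \<in> ?O"
      unfolding orbit_GL_centralizer[OF X] using mat_conjugator_mult[OF gh g'(1)] by blast
  qed
  then show ?thesis
    using continuous_map_image_closure_subset[OF continuous_map_coadjoint[OF gh]] \<phi> closure_of_mono
    by (metis image_subset_iff subsetD)
qed

text \<open>The target lives in another frame, with \<open>S'\<close> in place of \<open>S\<close>;
  the matrix \<open>g\<close> transports it back to the frame of \<open>S\<close>, where the orbit
  of the centralizer is taken.\<close>

lemma degenerates_closure_orbit:
  fixes S X :: "'a::local_field_char_0 mat"
  assumes "degenerates n S X S' X'"
  shows "\<exists>g h. mat_conjugator n g h \<and> g * S' = S * g \<and> trace_form n (g * X' * h) \<in>
    gl_dual_topology n closure_of orbit (GL_centralizer n S) (coadjoint n) (trace_form n X)"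
  using assms
proof (induction rule: degenerates.induct)
  case refl
  let ?O = "orbit (GL_centralizer n S) (coadjoint n) (trace_form n X)"
  have "trace_form n (1\<^sub>m n * X * 1\<^sub>m n) \<in> ?O"
    unfolding orbit_GL_centralizer[OF refl(2)] using mat_conjugator_one refl(1) by fastforce
  moreover have "?O \<subseteq> topspace (gl_dual_topology n)"
    unfolding orbit_GL_centralizer[OF refl(2)]
    using refl(2) by (auto simp: mat_conjugator_def intro!: trace_form_in_gl_dual)
  ultimately have "trace_form n (1\<^sub>m n * X * 1\<^sub>m n) \<in> gl_dual_topology n closure_of ?O"
    using closure_of_subset by blast
  moreover have "1\<^sub>m n * S = S * 1\<^sub>m n" using refl by simp
  ultimately show ?case using mat_conjugator_one by blast
next
  case (step S' X' S'' X'')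
  let ?C = "gl_dual_topology n closure_of orbit (GL_centralizer n S) (coadjoint n) (trace_form n X)"
  have car: "S \<in> carrier_mat n n" "X \<in> carrier_mat n n" "S' \<in> carrier_mat n n" "X' \<in> carrier_mat n n"
    "S'' \<in> carrier_mat n n" "X'' \<in> carrier_mat n n"
    using degenerates_carrier[OF step.hyps(1)] one_step_degenerates_carrier[OF step.hyps(2)] by auto
  obtain g h where gh: "mat_conjugator n g h" and gS: "g * S' = S * g"
    and IH: "trace_form n (g * X' * h) \<in> ?C" using step.IH by blast
  obtain E where E: "E \<in> carrier_mat n n" and deg: "\<And>t. t \<noteq> 0 \<Longrightarrow>
      \<exists>P Q. mat_conjugator n P Q \<and> P * S' = S'' * P \<and> P * X' = (X'' + t \<cdot>\<^sub>m E) * P"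
    using step.hyps(2) unfolding one_step_degenerates_def by blast
  \<comment> \<open>The member at \<open>t = 1\<close> serves as a fixed identification of the
    frames of \<open>S'\<close> and \<open>S''\<close>; the conjugators for other \<open>t\<close>
    are compared with it.\<close>
  obtain P1 Q1 where P1: "mat_conjugator n P1 Q1" "P1 * S' = S'' * P1"
    using deg[of 1] by auto
  have Q1: "Q1 * S'' = S' * Q1" by (rule mat_conjugator_intertwine[OF P1(1) _ _ P1(2)]) (use car in auto)
  have hS: "h * S = S' * h" by (rule mat_conjugator_intertwine[OF gh _ _ gS]) (use car in auto)
  have car': "g \<in> carrier_mat n n" "h \<in> carrier_mat n n" "P1 \<in> carrier_mat n n" "Q1 \<in> carrier_mat n n"
    using gh P1 by (auto simp: mat_conjugator_def)
  note assoc = assoc_mult_mat[of _ n n _ n _ n]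
  \<comment> \<open>The line through \<open>X''\<close> in direction \<open>E\<close>, transported
    to the frame of \<open>S\<close>. The transporting matrix does not depend on \<open>t\<close>,
    so the result is again a line.\<close>
  define A where "A = (g * Q1) * X'' * (P1 * h)"
  define B where "B = (g * Q1) * E * (P1 * h)"
  have AB: "A \<in> carrier_mat n n" "B \<in> carrier_mat n n" using car car' E by (auto simp: A_def B_def)
  have ABt: "A + t \<cdot>\<^sub>m B = (g * Q1) * (X'' + t \<cdot>\<^sub>m E) * (P1 * h)" for t
    unfolding A_def B_def using car car' E
    by (simp add: mult_add_distrib_mat[of _ n n _ n] add_mult_distrib_mat[of _ n n _ _ n]
        mult_smult_distrib[of _ n n _ n] mult_smult_assoc_mat[of _ n n _ n])
  have inC: "trace_form n (A + t \<cdot>\<^sub>m B) \<in> ?C" if t: "t \<noteq> 0" for t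
  proof -
    obtain P Q where P: "mat_conjugator n P Q" "P * S' = S'' * P" "P * X' = (X'' + t \<cdot>\<^sub>m E) * P"
      using deg[OF t] by blast
    have carP: "P \<in> carrier_mat n n" "Q \<in> carrier_mat n n" using P by (auto simp: mat_conjugator_def)
    \<comment> \<open>Read from the right, \<open>k\<close> passes from the frame of
      \<open>S\<close> to that of \<open>S'\<close>, to that of \<open>S''\<close> by the conjugator
      for \<open>t\<close>, and back by the fixed one; being a round trip, it commutes with
      \<open>S\<close>.\<close>
    define k where "k = g * (Q1 * (P * h))"
    define l where "l = g * (Q * (P1 * h))"
    have kl: "mat_conjugator n k l"
      using mat_conjugator_mult[OF mat_conjugator_mult[OF gh mat_conjugator_sym[OF P1(1)]]
          mat_conjugator_mult[OF P(1) mat_conjugator_sym[OF gh]]] car' carP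
      by (simp add: k_def l_def assoc)
    have "k * S = g * (Q1 * (P * (h * S)))" using car car' carP by (simp add: k_def assoc)
    also have "\<dots> = g * (Q1 * ((P * S') * h))" using car car' carP by (simp add: hS assoc)
    also have "\<dots> = g * ((Q1 * S'') * (P * h))" using car car' carP by (simp add: P(2) assoc)
    also have "\<dots> = (g * S') * (Q1 * (P * h))" using car car' carP by (simp add: Q1 assoc)
    also have "\<dots> = S * k" using car car' carP by (simp add: gS assoc k_def)
    finally have kS: "k * S = S * k" .
    have carE: "X'' + t \<cdot>\<^sub>m E \<in> carrier_mat n n" using car E by auto
    have "k * (g * X' * h) * l = g * (Q1 * ((P * X') * (Q * (P1 * h))))"
      unfolding k_def l_def using car car' carP by (simp add: assoc mat_conjugator_cancel[OF gh])
    also have "\<dots> = g * (Q1 * ((X'' + t \<cdot>\<^sub>m E) * (P * (Q * (P1 * h)))))"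
      unfolding P(3) using carE car' carP by (simp add: assoc)
    also have "\<dots> = A + t \<cdot>\<^sub>m B"
      unfolding ABt using carE car' carP by (simp add: assoc mat_conjugator_cancel[OF P(1)])
    finally have "coadjoint n k (trace_form n (g * X' * h)) = trace_form n (A + t \<cdot>\<^sub>m B)"
      using car car' by (simp add: coadjoint_trace_form[OF kl])
    then show ?thesis
      using closure_orbit_centralizer_invariant[OF kl kS car(1,2) IH] by simp
  qed
  \<comment> \<open>The parameters whose point lies in the closure form a closed set that contains
    all \<open>t \<noteq> 0\<close>. If 0 were missing, its singleton would be open, against
    non-discreteness.\<close>
  have "closedin euclidean {t \<in> topspace euclidean. trace_form n (A + t \<cdot>\<^sub>m B) \<in> ?C}"
    by (rule closedin_continuous_map_preimage[OF continuous_map_trace_form_line[OF AB] closedin_closure_of])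
  then have closed: "closed {t. trace_form n (A + t \<cdot>\<^sub>m B) \<in> ?C}" by simp
  have "trace_form n (A + 0 \<cdot>\<^sub>m B) \<in> ?C"
  proof (rule ccontr)
    assume "\<not> ?thesis"
    then have "- {t. trace_form n (A + t \<cdot>\<^sub>m B) \<in> ?C} = {0}" using inC by auto
    then show False using closed not_open_singleton[of "0 :: 'a"] by (simp add: closed_def)
  qed
  moreover have "A + 0 \<cdot>\<^sub>m B = A" using AB by (intro eq_matI) auto
  ultimately have "trace_form n ((g * Q1) * X'' * (P1 * h)) \<in> ?C" by (simp add: A_def)
  moreover have "g * Q1 * S'' = S * (g * Q1)"
  proof -
    have "g * Q1 * S'' = g * (S' * Q1)" using car car' by (simp add: assoc Q1)
    also have "\<dots> = (g * S') * Q1" using car car' by (simp add: assoc)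
    also have "\<dots> = S * (g * Q1)" using car car' by (simp add: assoc gS)
    finally show ?thesis .
  qed
  moreover have "mat_conjugator n (g * Q1) (P1 * h)"
    using mat_conjugator_mult[OF gh mat_conjugator_sym[OF P1(1)]] .
  ultimately show ?case by blast
qed

section \<open>Whittaker pairs\<close>

definition elem_mat :: "nat \<Rightarrow> nat \<Rightarrow> nat \<Rightarrow> 'a::zero_neq_one mat" where
  "elem_mat n i j = mat n n (\<lambda>(r, s). if r = i \<and> s = j then 1 else 0)"

lemma elem_mat_carrier [simp]: "elem_mat n i j \<in> carrier_mat n n"
  by (simp add: elem_mat_def)

lemma elem_mat_inj:
  assumes "elem_mat n i j = (elem_mat n r s :: 'a::zero_neq_one mat)" "i < n" "j < n"
  shows "i = r" "j = s"
proof -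
  have "(elem_mat n r s :: 'a mat) $$ (i, j) = 1"
    using assms(2,3) unfolding assms(1)[symmetric] by (simp add: elem_mat_def)
  then show "i = r" "j = s" using assms(2,3) by (auto simp: elem_mat_def split: if_splits)
qed

context matrix_vs
begin

lemma index_lincomb_mat:
  assumes "i < nr" "j < nc" "finite A" "A \<subseteq> carrier_mat nr nc"
  shows "lincomb a A $$ (i, j) = (\<Sum>M\<in>A. a M * M $$ (i, j))"
  using assms(3,4)
proof (induction A rule: finite_induct)
  case empty
  then show ?case using assms by (simp add: lincomb_def)
next
  case (insert M A)
  then have M: "M \<in> carrier_mat nr nc" and A: "A \<subseteq> carrier_mat nr nc" by auto
  have "lincomb a (insert M A) = a M \<cdot>\<^sub>m M + lincomb a A"
    unfolding lincomb_def using insert.hyps M A by (subst finsum_insert) auto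
  moreover have "lincomb a A \<in> carrier_mat nr nc" using A by (intro lincomb_closed) auto
  then have "dim_row (lincomb a A) = nr" "dim_col (lincomb a A) = nc" by (rule carrier_matD)+
  ultimately show ?case using insert M A assms by simp
qed

end

lemma elem_mat_basis:
  "vectorspace.basis class_ring (module_mat TYPE('a::field) n n)
     ((\<lambda>(i, j). elem_mat n i j) ` ({..<n} \<times> {..<n}))"
proof -
  interpret matrix_vs n n "TYPE('a)" .
  let ?I = "{..<n} \<times> {..<n}"
  let ?B = "(\<lambda>(i, j). elem_mat n i j) ` ?I :: 'a mat set"
  have fin: "finite ?B" and car: "?B \<subseteq> carrier_mat n n" by auto
  have inj: "inj_on (\<lambda>(i, j). elem_mat n i j :: 'a mat) ?I"
    by (auto simp: inj_on_def dest: elem_mat_inj)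
  have coeff: "lincomb a ?B $$ (r, s) = a (elem_mat n r s)" if "r < n" "s < n" for a r s
  proof -
    have "lincomb a ?B $$ (r, s) = (\<Sum>M\<in>?B. a M * M $$ (r, s))"
      by (rule index_lincomb_mat[OF that fin car])
    also have "\<dots> = (\<Sum>x\<in>?I. a (elem_mat n (fst x) (snd x)) * elem_mat n (fst x) (snd x) $$ (r, s))"
      by (subst sum.reindex[OF inj]) (simp add: split_beta)
    also have "\<dots> = (\<Sum>x\<in>?I. if x = (r, s) then a (elem_mat n r s) else 0)"
      using that by (intro sum.cong) (auto simp: elem_mat_def)
    also have "\<dots> = a (elem_mat n r s)" using that by simp
    finally show ?thesis .
  qed
  have "lin_indpt ?B"
  proof (rule finite_lin_indpt2[OF fin])
    show "?B \<subseteq> carrier_mat n n" by (rule car)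
    fix a :: "'a mat \<Rightarrow> 'a" assume 0: "lincomb a ?B = 0\<^sub>m n n"
    show "\<forall>v\<in>?B. a v = 0"
    proof
      fix v assume "v \<in> ?B"
      then obtain i j where "i < n" "j < n" "v = elem_mat n i j" by auto
      then show "a v = 0" using coeff[of i j a] 0 by simp
    qed
  qed
  moreover have "span ?B = carrier_mat n n"
  proof
    show "span ?B \<subseteq> carrier_mat n n" using span_is_subset2[OF car] by simp
    show "carrier_mat n n \<subseteq> span ?B"
    proof
      fix M :: "'a mat" assume M: "M \<in> carrier_mat n n"
      \<comment> \<open>\<open>lincomb\<close> indexes coefficients by the matrices themselves, so
        the position is recovered from the elementary matrix.\<close>
      define a where "a v = M $$ (SOME x. x \<in> ?I \<and> v = elem_mat n (fst x) (snd x))" for v :: "'a mat"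
      have a: "a (elem_mat n i j) = M $$ (i, j)" if "i < n" "j < n" for i j
      proof -
        have "(SOME x. x \<in> ?I \<and> (elem_mat n i j :: 'a mat) = elem_mat n (fst x) (snd x)) = (i, j)"
          using that by (intro some_equality) (auto dest: elem_mat_inj)
        then show ?thesis by (simp add: a_def)
      qed
      have "lincomb a ?B \<in> carrier_mat n n" using car by (intro lincomb_closed) auto
      then have "M = lincomb a ?B" using M by (intro eq_matI) (auto simp: coeff a)
      then show "M \<in> span ?B" unfolding span_def using fin by auto
    qed
  qed
  ultimately show ?thesis using car by (simp add: basis_def)
qed

lemma index_mult_diagonal:
  fixes S :: "'a::semiring_0 mat"
  assumes S: "S \<in> carrier_mat n n" "diagonal_mat S" and X: "X \<in> carrier_mat n n" and ij: "i < n" "j < n"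
  shows "(S * X) $$ (i, j) = S $$ (i, i) * X $$ (i, j)" "(X * S) $$ (i, j) = X $$ (i, j) * S $$ (j, j)"
proof -
  have "(S * X) $$ (i, j) = (\<Sum>k<n. if k = i then S $$ (i, i) * X $$ (i, j) else 0)"
    unfolding index_mult_mat_sum[OF S(1) X ij]
    using S ij by (intro sum.cong) (auto simp: diagonal_mat_def)
  then show "(S * X) $$ (i, j) = S $$ (i, i) * X $$ (i, j)" using ij by simp
  have "(X * S) $$ (i, j) = (\<Sum>k<n. if k = j then X $$ (i, j) * S $$ (j, j) else 0)"
    unfolding index_mult_mat_sum[OF X S(1) ij]
    using S ij by (intro sum.cong) (auto simp: diagonal_mat_def)
  then show "(X * S) $$ (i, j) = X $$ (i, j) * S $$ (j, j)" using ij by simp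
qed

text \<open>Elementary matrices are eigenvectors, with differences of diagonal entries of
  \<open>S\<close> as eigenvalues.\<close>

lemma diagonal_rational_diagonalizable:
  fixes S :: "'a::field_char_0 mat"
  assumes S: "S \<in> carrier_mat n n" "diagonal_mat S" and int: "\<And>i. i < n \<Longrightarrow> S $$ (i, i) \<in> \<int>"
  shows "rational_diagonalizable n (lie_ad S)"
  unfolding rational_diagonalizable_def
proof (intro exI[of _ "(\<lambda>(i, j). elem_mat n i j) ` ({..<n} \<times> {..<n})"] conjI ballI elem_mat_basis)
  fix X :: "'a mat" assume "X \<in> (\<lambda>(i, j). elem_mat n i j) ` ({..<n} \<times> {..<n})"
  then obtain i j where ij: "i < n" "j < n" "X = elem_mat n i j" by auto
  obtain k l :: int where k: "S $$ (i, i) = of_int k" "S $$ (j, j) = of_int l"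
    using int ij by (metis Ints_cases)
  have "lie_ad S X = of_rat (of_int (k - l)) \<cdot>\<^sub>m X"
  proof (rule eq_matI)
    fix r s
    assume "r < dim_row (of_rat (of_int (k - l)) \<cdot>\<^sub>m X)" "s < dim_col (of_rat (of_int (k - l)) \<cdot>\<^sub>m X)"
    then have rs: "r < n" "s < n" by (auto simp: ij(3) elem_mat_def)
    have X: "X \<in> carrier_mat n n" by (simp add: ij(3))
    have "lie_ad S X $$ (r, s) = (S * X) $$ (r, s) - (X * S) $$ (r, s)"
      using rs S X by (simp add: lie_ad_def)
    also have "\<dots> = (S $$ (r, r) - S $$ (s, s)) * X $$ (r, s)"
      by (simp add: index_mult_diagonal[OF S X rs] algebra_simps)
    also have "\<dots> = (of_rat (of_int (k - l)) \<cdot>\<^sub>m X) $$ (r, s)"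
      using rs by (auto simp: ij(3) elem_mat_def k of_rat_diff)
    finally show "lie_ad S X $$ (r, s) = (of_rat (of_int (k - l)) \<cdot>\<^sub>m X) $$ (r, s)" .
  qed (use S in \<open>auto simp: lie_ad_def ij(3) elem_mat_def\<close>)
  then show "\<exists>q. lie_ad S X = of_rat q \<cdot>\<^sub>m X" by blast
qed

lemma segment_grading_diagonal:
  "diagonal_mat (segment_grading s :: 'a::field_char_0 mat)"
  "i < segment_size s \<Longrightarrow> segment_grading s $$ (i, i) \<in> (\<int> :: 'a set)"
proof (induction s arbitrary: i)
  case (Cons x s)
  obtain c k where x: "x = (c, k)" by fastforce
  { case 1
    then show ?case using Cons.IH(1) unfolding segment_Cons(1)[of x s]
      by (auto simp: diagonal_mat_def direct_sum_mat_index x segment_single_index)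
  next
    case 2
    then show ?case using Cons.IH(2)[of "i - k"] unfolding segment_Cons(1)[of x s]
      by (auto simp: direct_sum_mat_index x segment_single_index intro!: Ints_mult Ints_add) }
qed (auto simp: diagonal_mat_def)

lemma segment_commutator:
  "lie_ad (segment_grading s) (segment_jordan s) = (- 2 :: 'a::field_char_0) \<cdot>\<^sub>m segment_jordan s"
proof -
  let ?S = "segment_grading s :: 'a mat" and ?J = "segment_jordan s :: 'a mat"
  \<comment> \<open>A nonzero entry stays inside one block and raises the degree by one; between
    blocks the degrees jump arbitrarily, but the entry there is 0.\<close>
  have nz: "i = Suc j \<and> ?S $$ (i, i) = ?S $$ (j, j) - 2"
    if "i < segment_size s" "j < segment_size s" "?J $$ (i, j) \<noteq> 0" for i j
    using that
  proof (induction s arbitrary: i j)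
    case (Cons x s)
    obtain c k where x: "x = (c, k)" by fastforce
    show ?case
    proof (cases "i < k \<or> j < k")
      case True
      then show ?thesis using Cons.prems
        by (auto simp: segment_Cons[of "(c, k)" s] direct_sum_mat_index x segment_single_index split: if_splits)
    next
      case False
      then obtain i' j' where "i = k + i'" "j = k + j'" by (metis le_add_diff_inverse not_less)
      then show ?thesis using Cons.prems Cons.IH[of i' j']
        by (auto simp: segment_Cons[of "(c, k)" s] direct_sum_mat_index x split: if_splits)
    qed
  qed simp
  let ?n = "segment_size s"
  show ?thesis
  proof (rule eq_matI)
    fix i j assume "i < dim_row (- 2 \<cdot>\<^sub>m ?J)" "j < dim_col (- 2 \<cdot>\<^sub>m ?J)"
    then have ij: "i < ?n" "j < ?n" by auto
    have "lie_ad ?S ?J $$ (i, j) = (?S * ?J) $$ (i, j) - (?J * ?S) $$ (i, j)"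
      using ij by (simp add: lie_ad_def)
    also have "\<dots> = (?S $$ (i, i) - ?S $$ (j, j)) * ?J $$ (i, j)"
      by (simp add: index_mult_diagonal[OF segment_carrier(1) segment_grading_diagonal(1) segment_carrier(2) ij]
          algebra_simps)
    also have "\<dots> = - 2 * ?J $$ (i, j)"
      using nz[OF ij] by (cases "?J $$ (i, j) = 0") auto
    finally show "lie_ad ?S ?J $$ (i, j) = (- 2 \<cdot>\<^sub>m ?J) $$ (i, j)" using ij by simp
  qed (auto simp: lie_ad_def)
qed

text \<open>Invariance of the trace form: \<open>Tr(J [S, Y]) = - Tr([S, J] Y) = 2 Tr(J Y)\<close>,
  and the sign in \<open>lie_coad\<close> makes the eigenvalue -2.\<close>

lemma segment_whittaker_pair:
  "whittaker_pair (segment_size s) (segment_grading s :: 'a::field_char_0 mat)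
     (trace_form (segment_size s) (segment_jordan s))"
proof -
  let ?n = "segment_size s"
  let ?S = "segment_grading s :: 'a mat" and ?J = "segment_jordan s :: 'a mat"
  note car = segment_carrier[of s]
  have "lie_coad ?n ?S (trace_form ?n ?J) Y = - 2 * trace_form ?n ?J Y" if Y: "Y \<in> carrier_mat ?n ?n" for Y
  proof -
    note assoc = assoc_mult_mat[of _ ?n ?n _ ?n _ ?n]
    have minus: "mat_trace (A - B) = mat_trace A - mat_trace B"
      if "A \<in> carrier_mat ?n ?n" "B \<in> carrier_mat ?n ?n" for A B :: "'a mat"
      using that by (simp add: mat_trace_def sum_subtractf)
    have "mat_trace (?J * (?S * Y - Y * ?S)) = mat_trace (?J * (?S * Y)) - mat_trace (?J * (Y * ?S))"
      using Y car by (subst mult_minus_distrib_mat[of _ ?n ?n _ ?n]) (auto intro!: minus)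
    also have "mat_trace (?J * (Y * ?S)) = mat_trace ((?J * Y) * ?S)"
      using Y car by (simp add: assoc)
    also have "\<dots> = mat_trace (?S * (?J * Y))"
      using Y car by (intro mat_trace_mult_commute[of _ ?n ?n]) auto
    also have "mat_trace (?J * (?S * Y)) - mat_trace (?S * (?J * Y)) =
        - (mat_trace (?S * ?J * Y) - mat_trace (?J * ?S * Y))"
      using Y car by (simp add: assoc)
    also have "mat_trace (?S * ?J * Y) - mat_trace (?J * ?S * Y) = mat_trace (lie_ad ?S ?J * Y)"
      unfolding lie_ad_def using Y car
      by (subst minus_mult_distrib_mat[of _ ?n ?n _ _ ?n]) (auto intro!: minus[symmetric])
    also have "\<dots> = - 2 * mat_trace (?J * Y)"
      unfolding segment_commutator mult_smult_assoc_mat[OF car(2) Y]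
      by (rule mat_trace_smult[OF mult_carrier_mat[OF car(2) Y]])
    finally have "mat_trace (?J * (?S * Y - Y * ?S)) = 2 * mat_trace (?J * Y)" by simp
    moreover have "?S * Y - Y * ?S \<in> carrier_mat ?n ?n" using Y car by auto
    ultimately show ?thesis using Y by (simp add: lie_coad_def trace_form_def lie_ad_def)
  qed
  then have "lie_coad ?n ?S (trace_form ?n ?J) = (\<lambda>Y\<in>carrier_mat ?n ?n. - 2 * trace_form ?n ?J Y)"
    by (auto simp: lie_coad_def restrict_def)
  moreover have "rational_diagonalizable ?n (lie_ad ?S)"
    by (rule diagonal_rational_diagonalizable) (auto simp: segment_grading_diagonal)
  ultimately show ?thesis
    unfolding whittaker_pair_def using car trace_form_in_gl_dual[OF car(2)] by auto
qed

lemma segment_nilpotent_jordan_form: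
  "0 \<notin> set (map snd s) \<Longrightarrow> nilpotent_jordan_form (segment_size s) (segment_jordan s)"
  unfolding nilpotent_jordan_form_def
  by (intro conjI exI[of _ "map snd s"] segment_carrier)
    (auto simp: segment_jordan_def o_def case_prod_unfold)


section \<open>Closure relations bound the Jordan type\<close>

lemma continuous_map_field_add:
  fixes f g :: "'b \<Rightarrow> 'a::local_field_char_0"
  assumes "continuous_map T euclidean f" "continuous_map T euclidean g"
  shows "continuous_map T euclidean (\<lambda>x. f x + g x)"
  using assms by (simp add: continuous_map_atin tendsto_add)

lemma continuous_map_field_mult:
  fixes f g :: "'b \<Rightarrow> 'a::local_field_char_0"
  assumes "continuous_map T euclidean f" "continuous_map T euclidean g"
  shows "continuous_map T euclidean (\<lambda>x. f x * g x)"
  using assms by (simp add: continuous_map_atin tendsto_mult)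

lemma continuous_map_field_sum:
  fixes f :: "'i \<Rightarrow> 'b \<Rightarrow> 'a::local_field_char_0"
  assumes "\<And>i. i \<in> I \<Longrightarrow> continuous_map T euclidean (f i)"
  shows "continuous_map T euclidean (\<lambda>x. \<Sum>i\<in>I. f i x)"
  using assms by (induction I rule: infinite_finite_induct) (auto intro: continuous_map_field_add)

lemma continuous_map_field_prod:
  fixes f :: "'i \<Rightarrow> 'b \<Rightarrow> 'a::local_field_char_0"
  assumes "\<And>i. i \<in> I \<Longrightarrow> continuous_map T euclidean (f i)"
  shows "continuous_map T euclidean (\<lambda>x. \<Prod>i\<in>I. f i x)"
  using assms by (induction I rule: infinite_finite_induct) (auto intro: continuous_map_field_mult)

text \<open>The dimensions are prescribed at every argument, also outside \<open>topspace T\<close>,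
  so that products and determinants expand as identities of functions.\<close>

definition continuous_mat ::
  "'b topology \<Rightarrow> nat \<Rightarrow> nat \<Rightarrow> ('b \<Rightarrow> 'a::local_field_char_0 mat) \<Rightarrow> bool" where
  "continuous_mat T m n F \<longleftrightarrow>
     (\<forall>x. F x \<in> carrier_mat m n) \<and> (\<forall>i<m. \<forall>j<n. continuous_map T euclidean (\<lambda>x. F x $$ (i, j)))"

lemma continuous_mat_const: "A \<in> carrier_mat m n \<Longrightarrow> continuous_mat T m n (\<lambda>_. A)"
  by (simp add: continuous_mat_def)

lemma continuous_mat_mult:
  assumes F: "continuous_mat T m k F" and G: "continuous_mat T k n G"
  shows "continuous_mat T m n (\<lambda>x. F x * G x)"
  unfolding continuous_mat_def
proof (intro conjI allI impI)
  have car: "F x \<in> carrier_mat m k" "G x \<in> carrier_mat k n" for x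
    using F G by (auto simp: continuous_mat_def)
  show "F x * G x \<in> carrier_mat m n" for x by (rule mult_carrier_mat[OF car])
  fix i j assume ij: "i < m" "j < n"
  have "continuous_map T euclidean (\<lambda>x. \<Sum>l<k. F x $$ (i, l) * G x $$ (l, j))"
    using F G ij by (auto simp: continuous_mat_def intro!: continuous_map_field_sum continuous_map_field_mult)
  then show "continuous_map T euclidean (\<lambda>x. (F x * G x) $$ (i, j))"
    by (simp add: index_mult_mat_sum[OF car ij])
qed

lemma continuous_mat_pow:
  assumes "continuous_mat T n n F"
  shows "continuous_mat T n n (\<lambda>x. F x ^\<^sub>m p)"
proof (induction p)
  case 0
  have "dim_row (F x) = n" for x using assms by (auto simp: continuous_mat_def)
  then show ?case by (simp add: continuous_mat_const)
next
  case (Suc p)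
  then show ?case using continuous_mat_mult[OF Suc assms] by simp
qed

lemma continuous_map_det:
  assumes "continuous_mat T n n F"
  shows "continuous_map T euclidean (\<lambda>x. det (F x))"
proof -
  have "dim_row (F x) = n" "dim_col (F x) = n" for x using assms by (auto simp: continuous_mat_def)
  then have det: "det (F x) = (\<Sum>p | p permutes {0..<n}. signof p * (\<Prod>i = 0..<n. F x $$ (i, p i)))" for x
    by (simp add: det_def)
  show ?thesis unfolding det
  proof (intro continuous_map_field_sum continuous_map_field_mult continuous_map_field_prod)
    fix p i assume "p \<in> {p. p permutes {0..<n}}" "i \<in> {0..<n}"
    then show "continuous_map T euclidean (\<lambda>x. F x $$ (i, p i))"
      using assms permutes_in_image[of p "{0..<n}" i] by (auto simp: continuous_mat_def)
  qed auto
qed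

text \<open>The rank is lower semicontinuous: a minor that does not vanish at a point of the closure
  does not vanish at some point of the orbit either.\<close>

lemma rank_pow_le_of_closure_orbit:
  fixes X Y :: "'a::local_field_char_0 mat"
  assumes X: "X \<in> carrier_mat n n" and Y: "Y \<in> carrier_mat n n"
    and closure: "trace_form n X \<in> gl_dual_topology n closure_of orbit (GL n) (coadjoint n) (trace_form n Y)"
    and d: "rank_factorization n d (X ^\<^sub>m p)" and e: "rank_factorization n e (Y ^\<^sub>m p)"
  shows "d \<le> e"
proof (rule ccontr)
  assume "\<not> d \<le> e"
  then have less: "e < d" by simp
  let ?T = "gl_dual_topology n :: ('a mat \<Rightarrow> 'a) topology"
  obtain U V A B where UV: "U \<in> carrier_mat n d" "V \<in> carrier_mat d n" "A \<in> carrier_mat d n"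
    "B \<in> carrier_mat n d" "X ^\<^sub>m p = U * V" "A * U = 1\<^sub>m d" "V * B = 1\<^sub>m d"
    using d unfolding rank_factorization_def by blast
  obtain U' V' where UV': "U' \<in> carrier_mat n e" "V' \<in> carrier_mat e n" "Y ^\<^sub>m p = U' * V'"
    using e unfolding rank_factorization_def by blast
  \<comment> \<open>Recovers the matrix from the functional: the trace of \<open>Z\<close> times the
    elementary matrix at \<open>(j, i)\<close> is the entry \<open>(i, j)\<close> of
    \<open>Z\<close>, hence the exchanged indices.\<close>
  define M where "M \<phi> = mat n n (\<lambda>(i, j). \<phi> (elem_mat n j i))" for \<phi> :: "'a mat \<Rightarrow> 'a"
  \<comment> \<open>Built to take the value 1 at \<open>X\<close>; a rank \<open>e < d\<close> makes
    it vanish on the whole orbit of \<open>Y\<close>.\<close>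
  define h where "h \<phi> = det (A * (M \<phi> ^\<^sub>m p) * B)" for \<phi>
  have M: "M (trace_form n Z) = Z" if Z: "Z \<in> carrier_mat n n" for Z
  proof (rule eq_matI)
    fix i j assume "i < dim_row Z" "j < dim_col Z"
    then have ij: "i < n" "j < n" using Z by auto
    have "mat_trace (Z * elem_mat n j i) = (\<Sum>r<n. (Z * elem_mat n j i) $$ (r, r))"
      using Z by (simp add: mat_trace_def)
    also have "\<dots> = (\<Sum>r<n. \<Sum>k<n. Z $$ (r, k) * elem_mat n j i $$ (k, r))"
      by (intro sum.cong refl index_mult_mat_sum[OF Z elem_mat_carrier]) auto
    also have "\<dots> = (\<Sum>r<n. \<Sum>k<n. if k = j then if r = i then Z $$ (i, j) else 0 else 0)"
      by (intro sum.cong refl) (auto simp: elem_mat_def)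
    also have "\<dots> = Z $$ (i, j)" using ij by simp
    finally show "M (trace_form n Z) $$ (i, j) = Z $$ (i, j)"
      using ij by (simp add: M_def trace_form_def)
  qed (use Z in \<open>auto simp: M_def\<close>)
  have "continuous_mat ?T n n M"
    unfolding continuous_mat_def M_def by (auto intro!: continuous_map_gl_dual_eval)
  then have "continuous_map ?T euclidean h"
    unfolding h_def using UV
    by (intro continuous_map_det[of _ d] continuous_mat_mult[of _ d n _ d] continuous_mat_mult[of _ d n _ n]
        continuous_mat_pow continuous_mat_const)
  then have "h (trace_form n X) \<in> euclidean closure_of (h ` orbit (GL n) (coadjoint n) (trace_form n Y))"
    using continuous_map_image_closure_subset closure by blast
  moreover have "h ` orbit (GL n) (coadjoint n) (trace_form n Y) \<subseteq> {0}"
  proof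
    fix z assume "z \<in> h ` orbit (GL n) (coadjoint n) (trace_form n Y)"
    then obtain g k where gk: "mat_conjugator n g k" and z: "z = h (trace_form n (g * Y * k))"
      unfolding orbit_GL[OF Y] by blast
    have car: "g \<in> carrier_mat n n" "k \<in> carrier_mat n n" using gk by (auto simp: mat_conjugator_def)
    have "similar_mat_wit (g * Y * k) Y g k"
      by (rule similar_mat_witI[of _ _ n]) (use gk Y in \<open>auto simp: mat_conjugator_def\<close>)
    then have "(g * Y * k) ^\<^sub>m p = g * (U' * V') * k"
      using similar_mat_wit_pow_id UV'(3) by metis
    \<comment> \<open>The regrouped product factors through dimension \<open>e\<close>, which is
      smaller than its size \<open>d\<close>.\<close>
    then have "A * ((g * Y * k) ^\<^sub>m p) * B = (A * g * U') * (V' * k * B)"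
      using UV UV' car by (simp add: assoc_mult_mat[of _ _ n _ n _ n] assoc_mult_mat[of _ _ n _ n _ d]
        assoc_mult_mat[of _ _ n _ e _ n] assoc_mult_mat[of _ _ e _ n _ n]
        assoc_mult_mat[of _ _ e _ n _ d] assoc_mult_mat[of _ _ n _ e _ d] )
    then have "h (trace_form n (g * Y * k)) = det ((A * g * U') * (V' * k * B))"
      using car Y by (simp add: h_def M)
    also have "\<dots> = 0"
      by (rule det_mult_thin[OF _ _ less]) (use UV UV' car in auto)
    finally show "z \<in> {0}" using z by simp
  qed
  ultimately have "h (trace_form n X) \<in> euclidean closure_of {0}"
    using closure_of_mono by blast
  then have "h (trace_form n X) = 0" by simp
  moreover have "A * (X ^\<^sub>m p) * B = 1\<^sub>m d"
  proof -
    have "A * (U * V) * B = (A * U) * (V * B)"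
      using UV by (simp add: assoc_mult_mat[of _ d n _ d _ n] assoc_mult_mat[of _ d d _ n _ d]
          assoc_mult_mat[of _ d n _ n _ d] assoc_mult_mat[of _ n d _ n _ d])
    then show ?thesis using UV by simp
  qed
  then have "h (trace_form n X) = 1" by (simp add: h_def M[OF X])
  ultimately show False by simp
qed

section \<open>Orbits of similar matrices and their Jordan types\<close>

lemma similar_mat_conjugator:
  assumes "similar_mat A B" "A \<in> carrier_mat n n"
  shows "\<exists>P Q. mat_conjugator n P Q \<and> A = P * B * Q" "B \<in> carrier_mat n n"
proof -
  obtain m P Q where car: "{A, B, P, Q} \<subseteq> carrier_mat m m" and PQ: "P * Q = 1\<^sub>m m" "Q * P = 1\<^sub>m m"
    and A: "A = P * B * Q" using similar_matD[OF assms(1)] by blast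
  have "m = n" using car assms(2) by auto
  then show "\<exists>P Q. mat_conjugator n P Q \<and> A = P * B * Q" "B \<in> carrier_mat n n"
    using car PQ A by (auto simp: mat_conjugator_def)
qed

lemma trace_form_in_orbit:
  assumes "X \<in> carrier_mat n n"
  shows "trace_form n X \<in> orbit (GL n) (coadjoint n) (trace_form n X)"
proof -
  have "trace_form n (1\<^sub>m n * X * 1\<^sub>m n) \<in> orbit (GL n) (coadjoint n) (trace_form n X)"
    unfolding orbit_GL[OF assms] using mat_conjugator_one by blast
  then show ?thesis using assms by simp
qed

lemma orbit_GL_similar:
  fixes A B :: "'a::field mat"
  assumes A: "A \<in> carrier_mat n n" and sim: "similar_mat A B"
  shows "orbit (GL n) (coadjoint n) (trace_form n A) = orbit (GL n) (coadjoint n) (trace_form n B)"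
proof -
  have sub: "orbit (GL n) (coadjoint n) (trace_form n A) \<subseteq> orbit (GL n) (coadjoint n) (trace_form n B)"
    if A: "A \<in> carrier_mat n n" and sim: "similar_mat A B" for A B :: "'a mat"
  proof -
    note B = similar_mat_conjugator(2)[OF sim A]
    obtain P Q where PQ: "mat_conjugator n P Q" and AB: "A = P * B * Q"
      using similar_mat_conjugator(1)[OF sim A] by blast
    show ?thesis unfolding orbit_GL[OF A] orbit_GL[OF B]
    proof clarify
      fix g h :: "'a mat" assume gh: "mat_conjugator n g h"
      have car: "P \<in> carrier_mat n n" "Q \<in> carrier_mat n n" "g \<in> carrier_mat n n" "h \<in> carrier_mat n n"
        using PQ gh by (auto simp: mat_conjugator_def)
      have "g * A * h = (g * P) * B * (Q * h)"
        unfolding AB using car B by (simp add: assoc_mult_mat[of _ n n _ n _ n])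
      then show "\<exists>g' h'. trace_form n (g * A * h) = trace_form n (g' * B * h') \<and> mat_conjugator n g' h'"
        using mat_conjugator_mult[OF gh PQ] by metis
    qed
  qed
  show ?thesis
    using sub[OF A sim] sub[OF similar_mat_conjugator(2)[OF sim A] similar_mat_sym[OF sim]] by blast
qed

lemma similar_direct_sum_swap:
  fixes A :: "'a::field mat"
  assumes A: "A \<in> carrier_mat m m" and B: "B \<in> carrier_mat n n"
  shows "similar_mat (A \<boxplus> B) (B \<boxplus> A)"
proof -
  obtain P Q :: "'a mat" where PQ: "mat_conjugator (m + n) P Q"
    and comm: "P * (A \<boxplus> B) = (B \<boxplus> A) * P"
    using direct_sum_swap_conjugator[of m n] A B by blast
  have car: "A \<boxplus> B \<in> carrier_mat (m + n) (m + n)" "B \<boxplus> A \<in> carrier_mat (m + n) (m + n)"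
    using A B direct_sum_mat_carrier[OF B A] by (auto simp: add.commute)
  have "A \<boxplus> B = Q * (P * (A \<boxplus> B))"
    using mat_conjugator_cancel(2)[OF PQ car(1)] by simp
  then have "A \<boxplus> B = Q * (B \<boxplus> A) * P"
    unfolding comm using PQ car by (simp add: mat_conjugator_def assoc_mult_mat[of Q "m + n" "m + n" _ "m + n" P "m + n"])
  then show ?thesis
    using PQ car by (intro similar_matI[of _ _ Q P "m + n"]) (auto simp: mat_conjugator_def)
qed

lemma similar_direct_sum:
  assumes "similar_mat A B" "similar_mat C D"
  shows "similar_mat (A \<boxplus> C) (B \<boxplus> D)"
proof -
  obtain m n where "A \<in> carrier_mat m m" "B \<in> carrier_mat m m" "C \<in> carrier_mat n n" "D \<in> carrier_mat n n"
    using similar_matD[OF assms(1)] similar_matD[OF assms(2)] by auto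
  then show ?thesis
    using similar_mat_four_block_0_0[OF assms, of m n] by (simp add: direct_sum_mat_def)
qed

text \<open>In contrast to \<open>segments_degenerate_mset\<close>, only the lengths have to agree,
  because the grading is forgotten.\<close>

lemma segment_jordan_similar:
  "mset (map snd s) = mset (map snd s') \<Longrightarrow>
   similar_mat (segment_jordan s) (segment_jordan s' :: 'a::field_char_0 mat)"
proof (induction s arbitrary: s')
  case Nil
  then show ?case using similar_mat_refl[OF segment_carrier(2)[of "[]"]] by simp
next
  case (Cons x s)
  let ?J = "segment_jordan :: (int \<times> nat) list \<Rightarrow> 'a mat"
  have refl: "similar_mat (?J r) (?J r)" for r by (rule similar_mat_refl[OF segment_carrier(2)])
  have "snd x \<in># mset (map snd s')" unfolding Cons.prems[symmetric] by simp
  then obtain y where "y \<in> set s'" and y: "snd y = snd x" by auto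
  then obtain xs ys where s': "s' = xs @ y # ys" by (metis split_list)
  have "?J [x] = ?J [y]" using y by (simp add: segment_jordan_def split_beta)
  then have 1: "?J (x # s) = ?J [y] \<boxplus> ?J s" using segment_Cons(2)[of x s] by metis
  have 2: "similar_mat (?J [y] \<boxplus> ?J s) (?J [y] \<boxplus> ?J (xs @ ys))"
    by (intro similar_direct_sum refl Cons.IH) (use Cons.prems y in \<open>simp add: s'\<close>)
  have 3: "?J [y] \<boxplus> ?J (xs @ ys) = (?J [y] \<boxplus> ?J xs) \<boxplus> ?J ys"
    by (simp add: segment_append direct_sum_mat_assoc)
  have 4: "similar_mat ((?J [y] \<boxplus> ?J xs) \<boxplus> ?J ys) ((?J xs \<boxplus> ?J [y]) \<boxplus> ?J ys)"
    by (rule similar_direct_sum[OF similar_direct_sum_swap[OF segment_carrier(2) segment_carrier(2)] refl])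
  have 5: "(?J xs \<boxplus> ?J [y]) \<boxplus> ?J ys = ?J s'"
    by (simp add: s' segment_append direct_sum_mat_assoc segment_Cons(2)[of y ys])
  show ?case
    unfolding 1 by (rule similar_mat_trans[OF 2[unfolded 3] 4[unfolded 5]])
qed

lemma closure_excess_le:
  fixes X Y :: "'a::local_field_char_0 mat"
  assumes X: "X \<in> carrier_mat n n" "similar_mat X (segment_jordan s)"
    and Y: "Y \<in> carrier_mat n n" "similar_mat Y (segment_jordan s')"
    and closure: "orbit (GL n) (coadjoint n) (trace_form n X) \<subseteq>
      gl_dual_topology n closure_of orbit (GL n) (coadjoint n) (trace_form n Y)"
  shows "excess (mset (map snd s)) p \<le> excess (mset (map snd s')) p"
proof -
  note n = similar_mat_conjugator(2)[OF X(2,1)] similar_mat_conjugator(2)[OF Y(2,1)]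
  then have size: "segment_size s = n" "segment_size s' = n" by auto
  have "trace_form n (segment_jordan s :: 'a mat) \<in>
      gl_dual_topology n closure_of orbit (GL n) (coadjoint n) (trace_form n (segment_jordan s'))"
    using closure trace_form_in_orbit[OF n(1)]
    unfolding orbit_GL_similar[OF X] orbit_GL_similar[OF Y] by (rule subsetD)
  from rank_pow_le_of_closure_orbit[OF n this rank_factorization_segment_jordan[of s p, unfolded size]
      rank_factorization_segment_jordan[of s' p, unfolded size]]
  show ?thesis .
qed

theorem theorem4:
  fixes n :: nat
    and Orb Orb' :: "('a::local_field_char_0 mat \<Rightarrow> 'a) set"
  assumes "nilpotent_coadjoint_orbit n Orb"
    and "nilpotent_coadjoint_orbit n Orb'"
    and "Orb \<subseteq> gl_dual_topology n closure_of Orb'"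
  shows "\<exists>S \<phi>. whittaker_pair n S \<phi> \<and> \<phi> \<in> Orb' \<and>
           Orb \<inter> (gl_dual_topology n closure_of
             orbit (GL_centralizer n S) (coadjoint n) \<phi>) \<noteq> {} \<and>
           diagonal_mat S \<and> (\<forall>i<n. S $$ (i, i) \<in> \<int>) \<and>
           (\<exists>J. nilpotent_jordan_form n J \<and> \<phi> = trace_form n J)"
proof -
  obtain X where X: "nilpotent_mat n X" and Orb: "Orb = orbit (GL n) (coadjoint n) (trace_form n X)"
    using assms(1) unfolding nilpotent_coadjoint_orbit_def by blast
  obtain Y where Y: "nilpotent_mat n Y" and Orb': "Orb' = orbit (GL n) (coadjoint n) (trace_form n Y)"
    using assms(2) unfolding nilpotent_coadjoint_orbit_def by blast
  obtain l where l: "0 \<notin> set (map snd l)" "segment_size l = n" "similar_mat X (segment_jordan l)"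
    using nilpotent_similar_segment_jordan[OF X] by blast
  obtain m where m: "0 \<notin> set (map snd m)" "segment_size m = n" "similar_mat Y (segment_jordan m)"
    using nilpotent_similar_segment_jordan[OF Y] by blast
  have car: "X \<in> carrier_mat n n" "Y \<in> carrier_mat n n"
    using X Y by (auto simp: nilpotent_mat_def)
  have size: "excess (mset (map snd s)) 0 = segment_size s" for s
    by (induction s) auto
  \<comment> \<open>These lists have the lengths of \<open>m\<close> and \<open>l\<close>, but with
    starts chosen for the degeneration.\<close>
  obtain segs tsegs where segs: "mset (map snd segs) = mset (map snd m)"
    and tsegs: "mset (map snd tsegs) = mset (map snd l)"
    and deg: "segments_degenerate TYPE('a) segs tsegs"
  proof -
    have "0 \<notin># mset (map snd l)" using l(1) by auto
    moreover have "excess (mset (map snd l)) p \<le> excess (mset (map snd m)) p" for p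
      using closure_excess_le[OF car(1) l(3) car(2) m(3)] assms(3) unfolding Orb Orb' by blast
    moreover have "excess (mset (map snd l)) 0 = excess (mset (map snd m)) 0"
      unfolding size using l(2) m(2) by simp
    ultimately show thesis using exists_segments that by blast
  qed
  have n: "segment_size segs = n" using size[of segs] size[of m] m(2) segs by simp
  let ?S = "segment_grading segs :: 'a mat" and ?J = "segment_jordan segs :: 'a mat"
  have J: "?J \<in> carrier_mat n n" and tJ: "(segment_jordan tsegs :: 'a mat) \<in> carrier_mat n n"
    using n segments_degenerate_size[OF deg] by (auto intro!: carrier_matI)
  have simJ: "similar_mat Y ?J"
    using m(3) segment_jordan_similar[OF segs[symmetric]] similar_mat_trans by blast
  have simT: "similar_mat X (segment_jordan tsegs)"
    using l(3) segment_jordan_similar[OF tsegs[symmetric]] similar_mat_trans by blast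
  have inO': "trace_form n ?J \<in> Orb'"
    unfolding Orb' orbit_GL_similar[OF car(2) simJ] by (rule trace_form_in_orbit[OF J])
  have "degenerates n ?S ?J (segment_grading tsegs) (segment_jordan tsegs)"
    using deg unfolding segments_degenerate_def n .
  then obtain g h where gh: "mat_conjugator n g h" and
    closure: "trace_form n (g * segment_jordan tsegs * h) \<in>
      gl_dual_topology n closure_of orbit (GL_centralizer n ?S) (coadjoint n) (trace_form n ?J)"
    using degenerates_closure_orbit by blast
  \<comment> \<open>The frame change \<open>g\<close> does no harm here, since \<open>Orb\<close> is
    stable under all of \<open>GL n\<close>.\<close>
  have "trace_form n (g * segment_jordan tsegs * h) \<in> Orb"
    unfolding Orb orbit_GL_similar[OF car(1) simT] orbit_GL[OF tJ] using gh by blast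
  then have meets: "Orb \<inter> (gl_dual_topology n closure_of
      orbit (GL_centralizer n ?S) (coadjoint n) (trace_form n ?J)) \<noteq> {}"
    using closure by blast
  have "0 \<notin> set (map snd segs)" using m(1) segs by (metis set_mset_mset)
  then have form: "nilpotent_jordan_form n ?J" using segment_nilpotent_jordan_form n by metis
  show ?thesis
  proof (rule exI[of _ ?S], rule exI[of _ "trace_form n ?J"], intro conjI allI impI)
    show "whittaker_pair n ?S (trace_form n ?J)" using segment_whittaker_pair[of segs] n by simp
    show "diagonal_mat ?S" by (rule segment_grading_diagonal(1))
    show "?S $$ (i, i) \<in> \<int>" if "i < n" for i using that segment_grading_diagonal(2) n by blast
    show "\<exists>J. nilpotent_jordan_form n J \<and> trace_form n ?J = trace_form n J" using form by blast
  qed (rule inO' meets)+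
qed

end
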